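(* Let $q$ be a prime power with $q\equiv 1\pmod{20}$. Fix a primitive root $\alpha$ of $\mathbb{F}_q$ and set $\beta=\alpha^{(q-1)/5}$. Let $\chi$ be the quadratic residue character of $\mathbb{F}_q$. The following statements are equivalent: (i) $(q,5)$ gives a $3$-design; (ii) $(q,10)$ gives a $3$-design; (iii) $\chi(1+\beta)=-1$; (iv) there exists $\theta\in\mathbb{F}_q^\times$ such that $\chi(\theta)=-1$ and $\theta^2-4\theta-1=0$; (v) $5\notin\langle\alpha^4\rangle$ (i.e. the element $5=5\cdot 1\in\mathbb{F}_q$ is not a fourth power in $\mathbb{F}_q^\times$). Moreover, if $q=p$ is a prime, then each of the following conditions is also equivalent to each of (i)–(v): (vi) there is no $(x,y)\in\mathbb{Z}^2$ with $p=x^2+20y^2$; (vii) there is no $(x,y)\in\mathbb{Z}^2$ with $p=x^2+100y^2$.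
   Context: Let $q$ be a power of an odd prime. The group $\mathrm{PSL}(2,q)$ acts on the projective line $\mathrm{PG}(1,q)=\mathbb{F}_q\cup\{\infty\}$ by linear fractional transformations $z\mapsto (az+b)/(cz+d)$, where $a,b,c,d\in\mathbb{F}_q$ with $ad-bc$ a nonzero square (matrices taken modulo $\pm I$). A $k$-subset $B$ of $\mathrm{PG}(1,q)$ is a starter of a $3$-design if the orbit $\{gB: g\in\mathrm{PSL}(2,q)\}$ is the block set of a $3$-$(q+1,k,\lambda)$ design for some positive integer $\lambda$ (every $3$-subset of $\mathrm{PG}(1,q)$ lies in exactly $\lambda$ blocks). For $q\equiv1\pmod 4$ and a divisor $k$ of $q-1$, let $B$ be the unique subgroup of order $k$ of $\mathbb{F}_q^\times$ (equivalently $B=\langle\alpha^{(q-1)/k}\rangle$ for a primitive root $\alpha$); we say $(q,k)$ gives a $3$-design if $B$ is a starter of a $3$-design under $\mathrm{PSL}(2,q)$. The quadratic residue character $\chi:\mathbb{F}_q^\times\to\{\pm1\}$ is $\chi(a)=1$ if $a$ is a square in $\mathbb{F}_q^\times$ and $\chi(a)=-1$ otherwise. *)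

theory Defs
  imports "HOL-Computational_Algebra.Primes" "HOL-Library.Cardinality"
begin

text \<open>The projective line PG(1,q) over a finite field 'a is modelled as 'a option,
  with None playing the role of the point at infinity.\<close>

fun lft :: "'a::field \<times> 'a \<times> 'a \<times> 'a \<Rightarrow> 'a option \<Rightarrow> 'a option" where
  "lft (a, b, c, d) None = (if c = 0 then None else Some (a / c))"
| "lft (a, b, c, d) (Some z) =
     (if c * z + d = 0 then None else Some ((a * z + b) / (c * z + d)))"

text \<open>Matrices representing elements of PSL(2,q): determinant a nonzero square.\<close>
definition psl2 :: "('a::field \<times> 'a \<times> 'a \<times> 'a) set" where
  "psl2 = {(a, b, c, d). \<exists>s. s \<noteq> 0 \<and> a * d - b * c = s ^ 2}"

definition psl2_orbit :: "'a::field option set \<Rightarrow> 'a option set set" where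
  "psl2_orbit B = {lft g ` B | g. g \<in> psl2}"

definition starter_3design :: "'a::{field,finite} option set \<Rightarrow> bool" where
  "starter_3design B \<longleftrightarrow>
     (\<exists>lam::nat. lam > 0 \<and>
        (\<forall>T :: 'a option set. card T = 3 \<longrightarrow>
            card {X \<in> psl2_orbit B. T \<subseteq> X} = lam))"

text \<open>(q,k) gives a 3-design: the subgroup of order k of the multiplicative group
  (for k dividing q-1 this is {x. x^k = 1}) is a starter of a 3-design.\<close>
definition gives_3design :: "'a::{field,finite} itself \<Rightarrow> nat \<Rightarrow> bool" where
  "gives_3design (TYPE('a)) k \<longleftrightarrow> starter_3design (Some ` {x::'a. x ^ k = 1})"

definition qchi :: "'a::field \<Rightarrow> int" where
  "qchi x = (if x = 0 then 0 else if \<exists>y. y ^ 2 = x then 1 else -1)"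

definition primitive_root :: "'a::field \<Rightarrow> bool" where
  "primitive_root \<alpha> \<longleftrightarrow> \<alpha> \<noteq> 0 \<and> (\<forall>x. x \<noteq> 0 \<longrightarrow> (\<exists>n::nat. x = \<alpha> ^ n))"

end

theory Submission
  imports Defs "HOL-Number_Theory.Number_Theory" "HOL-Library.Discrete_Functions"
begin

text \<open>PSL(2,q) has two orbits of the same size on ordered triples of distinct points, told apart by
  \<open>\<chi> ((a - b) (b - c) (c - a))\<close>; hence \<open>B\<close> is a starter iff the sum of this character over all
  triples of \<open>B\<close> vanishes. For \<open>k = 5\<close> and \<open>k = 10\<close> that sum is a nonzero multiple of
  \<open>1 + \<chi> (1 + \<beta>)\<close>. The sign \<open>\<chi> (1 + \<beta>)\<close> is also that of the Gaussian periods of order 5, hence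
  of \<open>\<surd>5\<close> and of \<open>2 + \<surd>5\<close>.

  For \<open>q = p\<close> prime, Thue's lemma writes \<open>p\<close> as \<open>a ^ 2 + b ^ 2\<close> and as \<open>x ^ 2 + 5 * y ^ 2\<close>. From
  \<open>2 (2 + \<surd>5) (2 + i) = (2 + \<surd>5 + i) ^ 2\<close> with \<open>i = a / b\<close>, respectively from \<open>\<surd>5 i = x / y\<close>, the
  sign becomes a product of values of \<open>\<chi>\<close> at integers, and quadratic reciprocity, applied prime by
  prime, evaluates it as 1 iff \<open>5\<close> divides \<open>b\<close> (\<open>b\<close> even), respectively iff \<open>y\<close> is even.\<close>

section \<open>Triples under PSL(2,q)\<close>

locale primitive_element =
  fixes \<alpha> :: "'a::{field,finite}" and N :: nat
  assumes prim: "primitive_root \<alpha>" and card: "CARD('a) = Suc N" and even_N: "even N"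
begin

lemma nonzero [simp]: "\<alpha> \<noteq> 0"
  using prim by (simp add: primitive_root_def)

lemma powerE:
  assumes "x \<noteq> 0" obtains n where "x = \<alpha> ^ n"
  using prim assms by (auto simp: primitive_root_def)

lemma card_units: "card (UNIV - {0::'a}) = N"
  by (simp add: card_Diff_singleton card)

lemma N_pos: "N > 0"
proof -
  have "card (UNIV - {0::'a}) > 0"
    unfolding card_gt_0_iff by (metis DiffI UNIV_I empty_iff finite singletonD zero_neq_one)
  then show ?thesis by (simp add: card_units)
qed

text \<open>Exponents reduce modulo \<open>d\<close>, so the powers of \<open>\<alpha>\<close> below
  \<open>d\<close> already cover all \<open>N\<close> units.\<close>

lemma le_of_power_eq_1:
  assumes "\<alpha> ^ d = 1" "d > 0"
  shows "N \<le> d"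
proof -
  have "UNIV - {0} \<subseteq> (\<lambda>n. \<alpha> ^ n) ` {..<d}"
  proof
    fix x :: 'a
    assume "x \<in> UNIV - {0}"
    then obtain n where "x = \<alpha> ^ n" by (auto elim: powerE)
    also have "\<alpha> ^ n = \<alpha> ^ (d * (n div d) + n mod d)" by simp
    also have "\<dots> = \<alpha> ^ (n mod d)"
      by (simp only: power_add power_mult assms(1)) simp
    finally show "x \<in> (\<lambda>n. \<alpha> ^ n) ` {..<d}" using assms(2) by auto
  qed
  then have "N \<le> card ((\<lambda>n. \<alpha> ^ n) ` {..<d})"
    by (metis card_units card_mono finite_imageI finite_lessThan)
  also have "\<dots> \<le> d" using card_image_le[of "{..<d}"] by simp
  finally show ?thesis .
qed

lemma power_N: "\<alpha> ^ N = 1"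
proof -
  \<comment> \<open>Pigeonhole: \<open>N + 1\<close> powers lie among \<open>N\<close> units. Two of
    them agree, and \<open>le_of_power_eq_1\<close> forces their exponents to differ by exactly
    \<open>N\<close>.\<close>
  have "card ((\<lambda>n. \<alpha> ^ n) ` {..N}) \<le> N"
    unfolding card_units[symmetric] by (rule card_mono) auto
  then have "\<not> inj_on (\<lambda>n. \<alpha> ^ n) {..N}"
    by (metis card_atMost card_image not_less_eq_eq order_refl)
  then obtain i j where ij: "i < j" "j \<le> N" "\<alpha> ^ i = \<alpha> ^ j"
    by (auto simp: inj_on_def) (metis nat_neq_iff)
  then have "\<alpha> ^ i * \<alpha> ^ (j - i) = \<alpha> ^ i * 1"
    by (metis le_add_diff_inverse less_imp_le mult_1_right power_add)
  then have 1: "\<alpha> ^ (j - i) = 1" by (subst (asm) mult_left_cancel) auto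
  then have "N \<le> j - i" using le_of_power_eq_1 ij by simp
  then have "j - i = N" using ij by simp
  with 1 show ?thesis by simp
qed

lemma power_eq_1_iff: "\<alpha> ^ n = 1 \<longleftrightarrow> N dvd n"
proof
  assume *: "\<alpha> ^ n = 1"
  have "\<alpha> ^ n = \<alpha> ^ (N * (n div N) + n mod N)" by simp
  also have "\<dots> = \<alpha> ^ (n mod N)"
    by (simp only: power_add power_mult power_N) simp
  finally have "\<alpha> ^ (n mod N) = 1" using * by simp
  then show "N dvd n"
    using le_of_power_eq_1[of "n mod N"] mod_less_divisor[OF N_pos, of n]
    by (cases "n mod N = 0") (simp_all add: dvd_eq_mod_eq_0)
next
  assume "N dvd n"
  then show "\<alpha> ^ n = 1" by (auto simp: power_mult power_N)
qed

lemma qchi_power: "qchi (\<alpha> ^ n) = (if even n then 1 else -1)"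
proof (cases "even n")
  case True
  then obtain m where "n = m * 2" by (auto elim: evenE)
  then have "\<exists>y. y ^ 2 = \<alpha> ^ n" by (auto simp: power_mult)
  with True show ?thesis by (auto simp: qchi_def)
next
  case False
  have "y ^ 2 \<noteq> \<alpha> ^ n" for y
  proof
    assume *: "y ^ 2 = \<alpha> ^ n"
    then have "y \<noteq> 0" by auto
    then obtain m where "y = \<alpha> ^ m" by (rule powerE)
    \<comment> \<open>\<open>(N - 1) * n\<close> stands for the exponent \<open>- n\<close> modulo
      \<open>N\<close>; it is odd, since \<open>N\<close> is even and \<open>n\<close> odd.\<close>
    have "\<alpha> ^ (2 * m + (N - 1) * n) = \<alpha> ^ n * \<alpha> ^ ((N - 1) * n)"
      using * \<open>y = _\<close> by (simp add: power_add power_mult mult.commute)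
    also have "\<dots> = \<alpha> ^ (N * n)"
      using N_pos by (cases N) (simp_all flip: power_add)
    also have "\<dots> = 1" by (simp add: power_eq_1_iff)
    finally have "N dvd 2 * m + (N - 1) * n" by (simp only: power_eq_1_iff)
    then have "even (2 * m + (N - 1) * n)" using even_N dvd_trans by blast
    then show False using False even_N N_pos by auto
  qed
  with False show ?thesis by (auto simp: qchi_def)
qed

lemma qchi_mult: "qchi (x * y :: 'a) = qchi x * qchi y"
proof (cases "x = 0 \<or> y = 0")
  case False
  then obtain m n where "x = \<alpha> ^ m" "y = \<alpha> ^ n" by (metis powerE)
  then have "qchi (x * y) = qchi (\<alpha> ^ (m + n))" by (simp add: power_add)
  also have "\<dots> = qchi x * qchi y"
    using \<open>x = _\<close> \<open>y = _\<close> by (simp only: qchi_power) auto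
  finally show ?thesis .
qed (auto simp: qchi_def)

lemma qchi_sq: "x \<noteq> 0 \<Longrightarrow> qchi (x ^ 2 :: 'a) = 1"
  by (auto simp: qchi_def)

end

lemma qchi_eq_0_iff [simp]: "qchi x = 0 \<longleftrightarrow> x = 0"
  by (auto simp: qchi_def)

lemma qchi_0 [simp]: "qchi 0 = 0"
  by simp

lemma qchi_1 [simp]: "qchi 1 = 1"
  by (auto simp: qchi_def intro: exI[of _ 1])

lemma qchi_cases: "x \<noteq> 0 \<Longrightarrow> qchi x = 1 \<or> qchi x = -1"
  by (auto simp: qchi_def)

section \<open>Fractional linear maps in homogeneous coordinates\<close>

fun mdet :: "'a::field \<times> 'a \<times> 'a \<times> 'a \<Rightarrow> 'a" where
  "mdet (a, b, c, d) = a * d - b * c"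

fun mmult :: "'a::field \<times> 'a \<times> 'a \<times> 'a \<Rightarrow> 'a \<times> 'a \<times> 'a \<times> 'a \<Rightarrow> 'a \<times> 'a \<times> 'a \<times> 'a" where
  "mmult (a, b, c, d) (a', b', c', d') =
     (a * a' + b * c', a * b' + b * d', c * a' + d * c', c * b' + d * d')"

text \<open>The adjugate inverts \<open>g\<close> up to the scalar \<open>mdet g\<close>, which acts
  trivially on points. It has the same determinant as \<open>g\<close>, so square classes are kept
  without division.\<close>

fun madj :: "'a::field \<times> 'a \<times> 'a \<times> 'a \<Rightarrow> 'a \<times> 'a \<times> 'a \<times> 'a" where
  "madj (a, b, c, d) = (d, - b, - c, a)"

lemma mdet_mmult: "mdet (mmult g h) = mdet g * mdet h"
  by (cases g; cases h) (simp add: algebra_simps)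

lemma mdet_madj [simp]: "mdet (madj g) = mdet g"
  by (cases g) (simp add: algebra_simps)

text \<open>Homogeneous coordinates of a point of the projective line.\<close>

fun hx :: "'a::field option \<Rightarrow> 'a" where
  "hx None = 1" | "hx (Some z) = z"

fun hy :: "'a::field option \<Rightarrow> 'a" where
  "hy None = 0" | "hy (Some z) = 1"

lemma lft_eq:
  "lft (a, b, c, d) x =
     (if c * hx x + d * hy x = 0 then None
      else Some ((a * hx x + b * hy x) / (c * hx x + d * hy x)))"
  by (cases x) auto

text \<open>An invertible matrix sends no nonzero coordinate vector to zero, so \<open>lft\<close>
  is the linear action up to a factor \<open>l\<close>. Carrying \<open>l\<close> along replaces
  case distinctions at infinity.\<close>

lemma lft_homogeneous:
  assumes "mdet (a, b, c, d) \<noteq> 0"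
  obtains l where "l \<noteq> 0" "a * hx x + b * hy x = l * hx (lft (a, b, c, d) x)"
    "c * hx x + d * hy x = l * hy (lft (a, b, c, d) x)"
proof (cases "c * hx x + d * hy x = 0")
  case True
  have "a * hx x + b * hy x \<noteq> 0"
  proof
    assume *: "a * hx x + b * hy x = 0"
    have "mdet (a, b, c, d) * hx x = d * (a * hx x + b * hy x) - b * (c * hx x + d * hy x)"
      "mdet (a, b, c, d) * hy x = a * (c * hx x + d * hy x) - c * (a * hx x + b * hy x)"
      by (simp_all add: algebra_simps)
    then have "hx x = 0" "hy x = 0" using * True assms by simp_all
    then show False by (cases x) auto
  qed
  then show ?thesis using that[of "a * hx x + b * hy x"] True by (simp add: lft_eq)
next
  case False
  then show ?thesis using that[of "c * hx x + d * hy x"] by (simp add: lft_eq)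
qed

text \<open>The determinant of two coordinate vectors: \<open>a - b\<close> at finite points, and
  still meaningful at infinity.\<close>

definition bracket :: "'a::field option \<Rightarrow> 'a option \<Rightarrow> 'a" where
  "bracket x y = hx x * hy y - hx y * hy x"

lemma bracket_eq_0_iff [simp]: "bracket x y = 0 \<longleftrightarrow> x = y"
  by (cases x; cases y) (auto simp: bracket_def)

lemma eq_of_proportional:
  assumes "l \<noteq> 0" "l' \<noteq> 0" "l * hx x = l' * hx y" "l * hy x = l' * hy y"
  shows "x = y"
proof -
  have "l * bracket x y = (l * hx x) * hy y - (l * hy x) * hx y"
    by (simp add: bracket_def algebra_simps)
  also have "\<dots> = l' * bracket y y"
    unfolding assms(3,4) by (simp add: bracket_def algebra_simps)
  finally have "l * bracket x y = l' * bracket y y" .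
  then show ?thesis using assms(1) by (simp add: bracket_def flip: bracket_eq_0_iff)
qed

lemma lft_mmult:
  assumes "mdet g \<noteq> 0" "mdet h \<noteq> 0"
  shows "lft g (lft h x) = lft (mmult g h) x"
proof -
  obtain a b c d where g: "g = (a, b, c, d)" by (cases g)
  obtain a' b' c' d' where h: "h = (a', b', c', d')" by (cases h)
  obtain l where l: "l \<noteq> 0" "a' * hx x + b' * hy x = l * hx (lft h x)"
    "c' * hx x + d' * hy x = l * hy (lft h x)"
    using lft_homogeneous assms(2) unfolding h by metis
  obtain m where m: "m \<noteq> 0" "a * hx (lft h x) + b * hy (lft h x) = m * hx (lft g (lft h x))"
    "c * hx (lft h x) + d * hy (lft h x) = m * hy (lft g (lft h x))"
    using lft_homogeneous assms(1) unfolding g by metis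
  have "mdet (mmult g h) \<noteq> 0" using assms by (simp add: mdet_mmult)
  then obtain n where n: "n \<noteq> 0"
    "(a * a' + b * c') * hx x + (a * b' + b * d') * hy x = n * hx (lft (mmult g h) x)"
    "(c * a' + d * c') * hx x + (c * b' + d * d') * hy x = n * hy (lft (mmult g h) x)"
    using lft_homogeneous[of _ _ _ _ x] unfolding g h mmult.simps by metis
  show ?thesis
  proof (rule eq_of_proportional)
    show "l * m \<noteq> 0" "n \<noteq> 0" using l m n by auto
    have "l * m * hx (lft g (lft h x)) = a * (l * hx (lft h x)) + b * (l * hy (lft h x))"
      unfolding mult.assoc m(2)[symmetric] by (simp add: algebra_simps)
    also have "\<dots> = n * hx (lft (mmult g h) x)"
      unfolding l(2,3)[symmetric] n(2)[symmetric] by (simp add: algebra_simps)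
    finally show "l * m * hx (lft g (lft h x)) = n * hx (lft (mmult g h) x)" .
    have "l * m * hy (lft g (lft h x)) = c * (l * hx (lft h x)) + d * (l * hy (lft h x))"
      unfolding mult.assoc m(3)[symmetric] by (simp add: algebra_simps)
    also have "\<dots> = n * hy (lft (mmult g h) x)"
      unfolding l(2,3)[symmetric] n(3)[symmetric] by (simp add: algebra_simps)
    finally show "l * m * hy (lft g (lft h x)) = n * hy (lft (mmult g h) x)" .
  qed
qed

lemma lft_scalar: "k \<noteq> 0 \<Longrightarrow> lft (k, 0, 0, k) x = x"
  by (cases x) auto

lemma lft_madj:
  assumes "mdet g \<noteq> 0"
  shows "lft (madj g) (lft g x) = x" "lft g (lft (madj g) x) = x"
proof -
  have "mmult (madj g) g = (mdet g, 0, 0, mdet g)" "mmult g (madj g) = (mdet g, 0, 0, mdet g)"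
    by (cases g; simp add: algebra_simps)+
  then show "lft (madj g) (lft g x) = x" "lft g (lft (madj g) x) = x"
    using assms by (simp_all add: lft_mmult lft_scalar)
qed

text \<open>Each bracket is multiplied by \<open>mdet g\<close> and divided by the scaling factors
  of its two points. In the cyclic product every point occurs twice, so these factors combine to the
  square \<open>k ^ 2\<close>.\<close>

lemma bracket_lft:
  assumes "mdet g \<noteq> 0"
  obtains k where "k \<noteq> 0" "bracket (lft g x) (lft g y) * bracket (lft g y) (lft g z) *
    bracket (lft g z) (lft g x) * k ^ 2 =
    mdet g ^ 2 * (mdet g * (bracket x y * bracket y z * bracket z x))"
proof -
  obtain a b c d where g: "g = (a, b, c, d)" by (cases g)
  define D where "D = mdet g"
  have *: "\<exists>l. l \<noteq> 0 \<and> a * hx x + b * hy x = l * hx (lft g x) \<and>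
    c * hx x + d * hy x = l * hy (lft g x)" for x
    using lft_homogeneous assms unfolding g by metis
  then obtain l where l: "\<And>x. l x \<noteq> 0" "\<And>x. a * hx x + b * hy x = l x * hx (lft g x)"
    "\<And>x. c * hx x + d * hy x = l x * hy (lft g x)" by metis
  have br: "l x * l y * bracket (lft g x) (lft g y) = D * bracket x y" for x y
  proof -
    have "l x * l y * bracket (lft g x) (lft g y) =
      (l x * hx (lft g x)) * (l y * hy (lft g y)) - (l y * hx (lft g y)) * (l x * hy (lft g x))"
      by (simp add: bracket_def algebra_simps)
    also have "\<dots> = D * bracket x y"
      unfolding l(2,3)[symmetric] D_def by (simp add: g bracket_def algebra_simps)
    finally show ?thesis .
  qed
  have "bracket (lft g x) (lft g y) * bracket (lft g y) (lft g z) *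
    bracket (lft g z) (lft g x) * (l x * l y * l z) ^ 2 =
    (l x * l y * bracket (lft g x) (lft g y)) * (l y * l z * bracket (lft g y) (lft g z)) *
    (l z * l x * bracket (lft g z) (lft g x))"
    by (simp add: power2_eq_square)
  also have "\<dots> = D ^ 2 * (D * (bracket x y * bracket y z * bracket z x))"
    unfolding br by (simp add: power2_eq_square)
  finally show ?thesis using that[of "l x * l y * l z"] l(1) by (simp add: D_def)
qed

text \<open>A matrix \<open>g\<close> multiplies the product of the three brackets by \<open>det g ^ 3\<close> up to squares, so
  elements of PSL(2,q) preserve the orientation of a triple; together with sharp 3-transitivity
  of PGL(2,q) it is a complete invariant of ordered triples.\<close>

definition orient :: "'a::field option \<Rightarrow> 'a option \<Rightarrow> 'a option \<Rightarrow> int" where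
  "orient x y z = qchi (bracket x y * bracket y z * bracket z x)"

lemma orient_eq_0_iff: "orient x y z = 0 \<longleftrightarrow> x = y \<or> y = z \<or> z = x"
  by (auto simp: orient_def)

lemma orient_cases: "x \<noteq> y \<Longrightarrow> y \<noteq> z \<Longrightarrow> z \<noteq> x \<Longrightarrow> orient x y z = 1 \<or> orient x y z = -1"
  unfolding orient_def by (rule qchi_cases) auto

lemma (in primitive_element) orient_lft:
  assumes "mdet g \<noteq> (0::'a)"
  shows "orient (lft g x) (lft g y) (lft g z) = qchi (mdet g) * orient x y z"
proof -
  obtain k where "k \<noteq> 0" and k: "bracket (lft g x) (lft g y) * bracket (lft g y) (lft g z) *
    bracket (lft g z) (lft g x) * k ^ 2 =
    mdet g ^ 2 * (mdet g * (bracket x y * bracket y z * bracket z x))"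
    using bracket_lft[OF assms] by metis
  from arg_cong[OF k, of qchi] show ?thesis
    unfolding qchi_mult[of _ "k ^ 2"] qchi_mult[of "mdet g ^ 2"] qchi_mult[of "mdet g"]
      qchi_sq[OF assms] qchi_sq[OF \<open>k \<noteq> 0\<close>] orient_def by simp
qed

lemma three_transitive_std:
  assumes "x \<noteq> y" "y \<noteq> z" "z \<noteq> (x :: 'a::field option)"
  obtains g where "mdet g \<noteq> 0" "lft g x = None" "lft g y = Some 0" "lft g z = Some 1"
proof -
  \<comment> \<open>The map sought is the cross ratio sending \<open>w\<close> to
    \<open>k * bracket w y / (m * bracket w x)\<close>; \<open>k\<close> and \<open>m\<close>
    normalise its value at \<open>z\<close> to 1.\<close>
  define k m where "k = bracket z x" and "m = bracket z y"
  have km: "k \<noteq> 0" "m \<noteq> 0" using assms by (auto simp: k_def m_def)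
  define g where "g = (k * hy y, - k * hx y, m * hy x, - m * hx x)"
  have "mdet g = k * m * bracket y x"
    by (simp add: g_def bracket_def algebra_simps)
  then have 0: "mdet g \<noteq> 0" using km assms by auto
  have 1: "lft g x = None"
    by (simp add: g_def lft_eq algebra_simps)
  have "m * hy x * hx y + (- m * hx x) * hy y = m * bracket y x"
    by (simp add: bracket_def algebra_simps)
  then have 2: "lft g y = Some 0"
    using km assms unfolding g_def lft_eq by (auto simp: algebra_simps)
  have "m * hy x * hx z + (- m * hx x) * hy z = m * k"
    "k * hy y * hx z + (- k * hx y) * hy z = m * k"
    by (simp_all add: bracket_def k_def m_def algebra_simps)
  then have 3: "lft g z = Some 1"
    using km assms unfolding g_def lft_eq by auto
  from that[OF 0 1 2 3] show ?thesis .
qed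

lemma lft_fixes_std:
  assumes "mdet g \<noteq> 0" "lft g None = None" "lft g (Some 0) = Some 0" "lft g (Some 1) = Some 1"
  shows "lft g x = x"
proof -
  obtain a b c d where g: "g = (a, b, c, d)" by (cases g)
  have "c = 0" using assms(2) by (auto simp: g split: if_splits)
  then have "d \<noteq> 0" using assms(1) by (auto simp: g)
  then have "b = 0" "a = d" using assms(3,4) \<open>c = 0\<close> by (auto simp: g)
  then show ?thesis using lft_scalar[OF \<open>d \<noteq> 0\<close>] \<open>c = 0\<close> by (simp add: g)
qed

lemma lft_eq_of_three:
  assumes "mdet g \<noteq> 0" "mdet h \<noteq> 0" "x \<noteq> y" "y \<noteq> z" "z \<noteq> x"
    and eq: "lft g x = lft h x" "lft g y = lft h y" "lft g z = lft h z"
  shows "lft g = lft h"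
proof
  fix w
  obtain s where s: "mdet s \<noteq> 0" "lft s x = None" "lft s y = Some 0" "lft s z = Some 1"
    using three_transitive_std assms(3-5) by metis
  \<comment> \<open>\<open>u\<close> is \<open>s h^-1 g s^-1\<close> with adjugates for inverses; it
    fixes infinity, 0 and 1, hence acts as the identity.\<close>
  define u where "u = mmult s (mmult (madj h) (mmult g (madj s)))"
  have u: "lft u v = lft s (lft (madj h) (lft g (lft (madj s) v)))" for v
    using assms s by (simp add: u_def lft_mmult mdet_mmult)
  have s': "lft (madj s) None = x" "lft (madj s) (Some 0) = y" "lft (madj s) (Some 1) = z"
    using lft_madj(1)[OF s(1)] s(2-4) by metis+
  have "mdet u \<noteq> 0" using assms s by (simp add: u_def mdet_mmult)
  then have "lft u v = v" for v
    by (rule lft_fixes_std) (simp_all add: u s' eq lft_madj[OF assms(2)] s del: lft.simps)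
  then have "lft s (lft (madj h) (lft g w)) = lft s w"
    using u[of "lft s w"] lft_madj(1)[OF s(1)] by simp
  then have "lft (madj h) (lft g w) = w"
    using lft_madj(1)[OF s(1)] by metis
  then show "lft g w = lft h w"
    using lft_madj(2)[OF assms(2)] by metis
qed

lemma psl2_iff: "g \<in> psl2 \<longleftrightarrow> (\<exists>s. s \<noteq> 0 \<and> mdet g = s ^ 2)"
  by (cases g) (auto simp: psl2_def)

lemma psl2_iff_qchi: "g \<in> psl2 \<longleftrightarrow> qchi (mdet g) = 1"
  unfolding psl2_iff qchi_def by (auto split: if_splits) (metis zero_power2)

lemma mdet_psl2: "g \<in> psl2 \<Longrightarrow> mdet g \<noteq> 0"
  by (auto simp: psl2_iff)

lemma mmult_psl2: "g \<in> psl2 \<Longrightarrow> h \<in> psl2 \<Longrightarrow> mmult g h \<in> psl2"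
  by (simp add: psl2_iff mdet_mmult) (metis mult_eq_0_iff power_mult_distrib)

lemma madj_psl2: "g \<in> psl2 \<Longrightarrow> madj g \<in> psl2"
  by (simp add: psl2_iff)

lemma (in primitive_element) psl2_transitive:
  assumes "x \<noteq> y" "y \<noteq> z" "z \<noteq> x" "orient x y z = orient x' y' (z' :: 'a option)"
  obtains g where "g \<in> psl2" "lft g x = x'" "lft g y = y'" "lft g z = z'"
proof -
  have d': "x' \<noteq> y'" "y' \<noteq> z'" "z' \<noteq> x'"
    using assms orient_eq_0_iff[of x y z] orient_eq_0_iff[of x' y' z'] by auto
  obtain s where s: "mdet s \<noteq> 0" "lft s x = None" "lft s y = Some 0" "lft s z = Some 1"
    using three_transitive_std assms(1-3) by metis
  obtain t where t: "mdet t \<noteq> 0" "lft t x' = None" "lft t y' = Some 0" "lft t z' = Some 1"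
    using three_transitive_std d' by metis
  define g where "g = mmult (madj t) s"
  have d: "mdet g \<noteq> 0" using s t by (simp add: g_def mdet_mmult)
  have g: "lft g x = x'" "lft g y = y'" "lft g z = z'"
    using s t lft_madj(1)[OF t(1)] unfolding g_def
    by (metis lft_mmult mdet_madj)+
  \<comment> \<open>The two orientations agree and are nonzero, so \<open>orient_lft\<close> leaves
    no other value for the character of the determinant.\<close>
  have "qchi (mdet g) = 1"
    using orient_lft[OF d, of x y z] assms(1-4) orient_cases[of x y z] by (auto simp: g)
  then show ?thesis using that g by (simp add: psl2_iff_qchi)
qed

section \<open>Counting blocks through a triple\<close>

lemma (in primitive_element) card_psl2_into:
  assumes d: "x \<noteq> y" "y \<noteq> z" "z \<noteq> (x :: 'a option)"
  shows "card {f \<in> lft ` psl2. f ` {x, y, z} \<subseteq> B} =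
    card {(u, v, w). u \<in> B \<and> v \<in> B \<and> w \<in> B \<and> orient u v w = orient x y z}"
proof (rule bij_betw_same_card)
  \<comment> \<open>A map is determined by its images of three points, and the possible images are
    exactly the triples of equal orientation. Maps \<open>lft g\<close> are counted rather than
    matrices, since proportional matrices act alike.\<close>
  show "bij_betw (\<lambda>f. (f x, f y, f z)) {f \<in> lft ` psl2. f ` {x, y, z} \<subseteq> B}
    {(u, v, w). u \<in> B \<and> v \<in> B \<and> w \<in> B \<and> orient u v w = orient x y z}"
    unfolding bij_betw_def
  proof (intro conjI inj_onI equalityI subsetI)
    fix f f'
    assume "f \<in> {f \<in> lft ` psl2. f ` {x, y, z} \<subseteq> B}" "f' \<in> {f \<in> lft ` psl2. f ` {x, y, z} \<subseteq> B}"
      "(f x, f y, f z) = (f' x, f' y, f' z)"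
    then obtain g g' where "f = lft g" "g \<in> psl2" "f' = lft g'" "g' \<in> psl2"
      "f x = f' x" "f y = f' y" "f z = f' z" by blast
    then show "f = f'" using lft_eq_of_three[OF _ _ d] mdet_psl2 by metis
  next
    fix t
    assume "t \<in> (\<lambda>f. (f x, f y, f z)) ` {f \<in> lft ` psl2. f ` {x, y, z} \<subseteq> B}"
    then obtain g where "g \<in> psl2" "t = (lft g x, lft g y, lft g z)"
      "lft g x \<in> B" "lft g y \<in> B" "lft g z \<in> B" by blast
    then show "t \<in> {(u, v, w). u \<in> B \<and> v \<in> B \<and> w \<in> B \<and> orient u v w = orient x y z}"
      using orient_lft[OF mdet_psl2, of g x y z] by (simp add: psl2_iff_qchi)
  next
    fix t
    assume "t \<in> {(u, v, w). u \<in> B \<and> v \<in> B \<and> w \<in> B \<and> orient u v w = orient x y z}"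
    then obtain u v w where t: "t = (u, v, w)" "u \<in> B" "v \<in> B" "w \<in> B"
      "orient x y z = orient u v w" by auto
    obtain g where "g \<in> psl2" "lft g x = u" "lft g y = v" "lft g z = w"
      using psl2_transitive[OF d t(5)] .
    then show "t \<in> (\<lambda>f. (f x, f y, f z)) ` {f \<in> lft ` psl2. f ` {x, y, z} \<subseteq> B}"
      using t by (intro image_eqI[of _ _ "lft g"]) auto
  qed
qed

lemma psl2_inverse:
  assumes "f \<in> lft ` psl2"
  obtains f' where "f' \<in> lft ` psl2" "\<And>x. f' (f x) = x" "\<And>x. f (f' x) = x"
proof -
  obtain g where g: "g \<in> psl2" "f = lft g" using assms by auto
  show ?thesis
    by (rule that[of "lft (madj g)"])
      (use g in \<open>auto simp: madj_psl2 lft_madj[OF mdet_psl2[OF g(1)]]\<close>)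
qed

lemma psl2_comp:
  assumes "f \<in> lft ` psl2" "g \<in> lft ` psl2"
  shows "f \<circ> g \<in> lft ` psl2"
proof -
  obtain h k where "h \<in> psl2" "f = lft h" "k \<in> psl2" "g = lft k" using assms by auto
  then show ?thesis
    by (intro image_eqI[of _ _ "mmult h k"]) (auto simp: lft_mmult mdet_psl2 mmult_psl2)
qed

text \<open>Orbit counting: inversion turns the maps sending \<open>T\<close> into \<open>B\<close>
  into the maps whose image of \<open>B\<close> contains \<open>T\<close>. Grouped by the block they
  produce, these fall into cosets of the stabiliser of \<open>B\<close>.\<close>

lemma card_blocks:
  fixes B T :: "'a::{field,finite} option set"
  shows "card {X \<in> psl2_orbit B. T \<subseteq> X} * card {f \<in> lft ` psl2. f ` B = B} =
    card {f \<in> lft ` psl2. f ` T \<subseteq> B}"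
proof -
  define G :: "('a option \<Rightarrow> 'a option) set" where "G = lft ` psl2"
  have inv: "\<exists>f'\<in>G. (\<forall>x. f' (f x) = x) \<and> (\<forall>x. f (f' x) = x)" if "f \<in> G" for f
    using psl2_inverse that unfolding G_def by metis
  have comp: "f \<circ> g \<in> G" if "f \<in> G" "g \<in> G" for f g
    using psl2_comp that unfolding G_def by metis
  obtain i where i: "\<And>f. f \<in> G \<Longrightarrow> i f \<in> G" "\<And>f x. f \<in> G \<Longrightarrow> i f (f x) = x"
    "\<And>f x. f \<in> G \<Longrightarrow> f (i f x) = x" using inv by metis
  have i_i: "i (i f) = f" if "f \<in> G" for f
    using i that by (metis ext)
  have i_sub: "f ` T \<subseteq> B \<longleftrightarrow> T \<subseteq> i f ` B" if "f \<in> G" for f and T B :: "'a option set"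
  proof
    assume "f ` T \<subseteq> B"
    then have "i f ` f ` T \<subseteq> i f ` B" by blast
    then show "T \<subseteq> i f ` B" using i(2)[OF that] by (simp add: image_image)
  next
    assume "T \<subseteq> i f ` B"
    then have "f ` T \<subseteq> f ` i f ` B" by blast
    then show "f ` T \<subseteq> B" using i(3)[OF that] by (simp add: image_image)
  qed
  have orbit: "psl2_orbit B = (\<lambda>f. f ` B) ` G"
    by (auto simp: psl2_orbit_def G_def)
  have fibre: "card {f \<in> G. f ` B = X} = card {f \<in> G. f ` B = B}" if X: "X \<in> psl2_orbit B" for X
  proof -
    obtain h where h: "h \<in> G" "X = h ` B" using X unfolding orbit by blast
    show ?thesis
    proof (rule bij_betw_same_card[of "\<lambda>f. i h \<circ> f"], rule bij_betw_byWitness)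
      show "\<forall>f\<in>{f \<in> G. f ` B = X}. h \<circ> (i h \<circ> f) = f" "\<forall>f\<in>{f \<in> G. f ` B = B}. i h \<circ> (h \<circ> f) = f"
        using i(2,3)[OF h(1)] by (simp_all add: fun_eq_iff)
      have "(i h \<circ> f) ` B = B" if "f ` B = X" for f
        unfolding image_comp[symmetric] that h(2) using i(2)[OF h(1)] by (simp add: image_image)
      then show "(\<lambda>f. i h \<circ> f) ` {f \<in> G. f ` B = X} \<subseteq> {f \<in> G. f ` B = B}"
        using comp[OF i(1)[OF h(1)]] by (intro image_subsetI) simp
      have "(h \<circ> f) ` B = X" if "f ` B = B" for f
        unfolding image_comp[symmetric] that using h(2) by simp
      then show "(\<lambda>f. h \<circ> f) ` {f \<in> G. f ` B = B} \<subseteq> {f \<in> G. f ` B = X}"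
        using comp[OF h(1)] by (intro image_subsetI) simp
    qed
  qed
  have "card {f \<in> G. f ` T \<subseteq> B} = card {f \<in> G. T \<subseteq> f ` B}"
  proof (rule bij_betw_same_card[of i], rule bij_betw_byWitness)
    show "i ` {f \<in> G. f ` T \<subseteq> B} \<subseteq> {f \<in> G. T \<subseteq> f ` B}"
      using i(1) i_sub by auto
    show "i ` {f \<in> G. T \<subseteq> f ` B} \<subseteq> {f \<in> G. f ` T \<subseteq> B}"
      using i(1) i_sub[OF i(1)] i_i by (intro image_subsetI) simp
  qed (use i_i in auto)
  also have "{f \<in> G. T \<subseteq> f ` B} = (\<Union>X\<in>{X \<in> psl2_orbit B. T \<subseteq> X}. {f \<in> G. f ` B = X})"
    by (auto simp: orbit)
  also have "card \<dots> = (\<Sum>X\<in>{X \<in> psl2_orbit B. T \<subseteq> X}. card {f \<in> G. f ` B = X})"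
    by (rule card_UN_disjoint) auto
  also have "\<dots> = card {X \<in> psl2_orbit B. T \<subseteq> X} * card {f \<in> G. f ` B = B}"
    by (simp add: fibre)
  finally show ?thesis by (simp add: G_def)
qed

definition orient_count :: "'a::field option set \<Rightarrow> int \<Rightarrow> nat" where
  "orient_count B e = card {(u, v, w). u \<in> B \<and> v \<in> B \<and> w \<in> B \<and> orient u v w = e}"

text \<open>Multiplied by the order of the stabiliser, the number of blocks through a triple becomes
  the \<open>orient_count\<close> of its orientation. Both orientations occur, so a constant block
  number means that the two counts coincide.\<close>

lemma (in primitive_element) starter_3design_iff_count:
  fixes B :: "'a option set"
  shows "starter_3design B \<longleftrightarrow> orient_count B 1 = orient_count B (-1) \<and> orient_count B 1 > 0"
proof -
  define st where "st = card {f \<in> lft ` psl2. f ` B = B}"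
  have "lft (1, 0, 0, 1) ` B = B" "(1, 0, 0, 1::'a) \<in> psl2"
    using lft_scalar[of "1::'a"] by (auto simp: psl2_iff intro!: exI[of _ 1])
  then have "lft (1, 0, 0, 1) \<in> {f \<in> lft ` psl2. f ` B = B}" by blast
  moreover have "finite {f \<in> lft ` psl2. f ` B = B}" by simp
  ultimately have st: "st > 0" unfolding st_def card_gt_0_iff by blast
  have count: "card {X \<in> psl2_orbit B. {x, y, z} \<subseteq> X} * st = orient_count B (orient x y z)"
    if "x \<noteq> y" "y \<noteq> z" "z \<noteq> x" for x y z
    using card_blocks[of B "{x, y, z}"] card_psl2_into[OF that, of B]
    by (simp only: st_def orient_count_def)
  have \<open>qchi \<alpha> = -1\<close> using qchi_power[of 1] by simp
  then have "\<alpha> \<noteq> 0" "\<alpha> \<noteq> 1" by auto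
  \<comment> \<open>The orientation of infinity, 0 and \<open>c\<close> is \<open>qchi c\<close>, so
    the square 1 and the nonsquare \<open>\<alpha>\<close> represent both types.\<close>
  have T0: "orient None (Some 0) (Some (1::'a)) = 1"
    and T1: "orient None (Some 0) (Some \<alpha>) = -1"
    using \<open>qchi \<alpha> = -1\<close> by (simp_all add: orient_def bracket_def)
  show ?thesis
  proof
    assume "starter_3design B"
    then obtain lam where lam: "lam > 0"
      "\<And>T :: 'a option set. card T = 3 \<Longrightarrow> card {X \<in> psl2_orbit B. T \<subseteq> X} = lam"
      unfolding starter_3design_def by blast
    have "lam * st = orient_count B 1"
      using count[of None "Some 0" "Some 1"] lam(2)[of "{None, Some 0, Some 1}"] T0 by simp
    moreover have "lam * st = orient_count B (-1)"
      using count[of None "Some 0" "Some \<alpha>"] lam(2)[of "{None, Some 0, Some \<alpha>}"] T1 by simp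
    ultimately show "orient_count B 1 = orient_count B (-1) \<and> orient_count B 1 > 0"
      using st lam(1) by (metis mult_pos_pos)
  next
    assume *: "orient_count B 1 = orient_count B (-1) \<and> orient_count B 1 > 0"
    have c: "card {X \<in> psl2_orbit B. T \<subseteq> X} * st = orient_count B 1"
      if T3: "card T = 3" for T :: "'a option set"
    proof -
      obtain x y z where T: "T = {x, y, z}" "x \<noteq> y" "y \<noteq> z" "z \<noteq> x"
        using T3 by (auto simp: card_3_iff)
      then show ?thesis
        using count[OF T(2-4)] orient_cases[OF T(2-4)] * by auto
    qed
    define lam where "lam = orient_count B 1 div st"
    have lam: "card {X \<in> psl2_orbit B. T \<subseteq> X} = lam" if "card T = 3" for T :: "'a option set"
      using c[OF that] st unfolding lam_def by (metis nonzero_mult_div_cancel_right less_not_refl)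
    have "card {None, Some 0, Some (1::'a)} = 3" by simp
    from c[OF this] lam[OF this] * have "lam > 0" by (metis gr0I mult_0 less_not_refl)
    then show "starter_3design B"
      unfolding starter_3design_def using lam by blast
  qed
qed

lemma sum_sign_card:
  fixes f :: "'b \<Rightarrow> int"
  assumes "finite S" "\<And>s. s \<in> S \<Longrightarrow> f s \<in> {-1, 0, 1}"
  shows "sum f S = int (card {s \<in> S. f s = 1}) - int (card {s \<in> S. f s = -1})"
proof -
  have "sum f S = (\<Sum>s\<in>S. (if f s = 1 then 1 else 0) - (if f s = -1 then 1 else 0))"
    using assms(2) by (intro sum.cong) force+
  also have "\<dots> = int (card {s \<in> S. f s = 1}) - int (card {s \<in> S. f s = -1})"
    using assms(1) by (simp add: sum_subtractf sum.If_cases Int_def)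
  finally show ?thesis .
qed

text \<open>The sum is the difference of the two orientation counts, because degenerate triples
  contribute 0. Three distinct points in \<open>B\<close> make one count positive, so equality of
  the counts suffices.\<close>

lemma (in primitive_element) starter_3design_iff_sum:
  fixes B :: "'a set"
  assumes "card B \<ge> 3"
  shows "starter_3design (Some ` B) \<longleftrightarrow>
    (\<Sum>(a, b, c)\<in>B \<times> B \<times> B. qchi (a - b) * qchi (b - c) * qchi (c - a)) = 0"
proof -
  let ?f = "\<lambda>(a, b, c). qchi (a - b) * qchi (b - c) * qchi (c - a :: 'a)"
  have orient: "orient (Some a) (Some b) (Some c) = ?f (a, b, c)" for a b c :: 'a
    by (simp add: orient_def bracket_def qchi_mult)
  have cnt: "orient_count (Some ` B) e = card {s \<in> B \<times> B \<times> B. ?f s = e}" for e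
    unfolding orient_count_def
    by (rule bij_betw_same_card[of "\<lambda>(u, v, w). (the u, the v, the w)"],
        rule bij_betw_byWitness[of _ "\<lambda>(a, b, c). (Some a, Some b, Some c)"])
      (auto simp: orient)
  have "?f s \<in> {-1, 0, 1}" for s
    by (cases s) (auto simp: qchi_def)
  then have "sum ?f (B \<times> B \<times> B) =
    int (orient_count (Some ` B) 1) - int (orient_count (Some ` B) (-1))"
    unfolding cnt by (intro sum_sign_card) auto
  moreover have "orient_count (Some ` B) 1 > 0 \<or> orient_count (Some ` B) (-1) > 0"
  proof -
    obtain C where "C \<subseteq> B" "card C = 3" using assms obtain_subset_with_card_n by metis
    then obtain a b c where abc: "a \<in> B" "b \<in> B" "c \<in> B" "a \<noteq> b" "b \<noteq> c" "c \<noteq> a"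
      by (auto simp: card_3_iff)
    then have "orient (Some a) (Some b) (Some c) = 1 \<or> orient (Some a) (Some b) (Some c) = -1"
      by (intro orient_cases) auto
    then have "(a, b, c) \<in> {s \<in> B \<times> B \<times> B. ?f s = 1} \<or> (a, b, c) \<in> {s \<in> B \<times> B \<times> B. ?f s = -1}"
      using abc orient[of a b c] by auto
    then show ?thesis unfolding cnt by (auto simp: card_gt_0_iff simp del: mem_Collect_eq)
  qed
  ultimately show ?thesis unfolding starter_3design_iff_count by auto
qed

section \<open>The subgroups of order 5 and 10\<close>

lemma sum_lessThan_5: "(\<Sum>i<5. g i) = g 0 + g (Suc 0) + g 2 + g 3 + (g 4 :: int)"
  by (simp add: eval_nat_numeral)

lemma sum_lessThan_10: "(\<Sum>i<10. g i) =
    g 0 + g (Suc 0) + g 2 + g 3 + g 4 + g 5 + g 6 + g 7 + g 8 + (g 9 :: int)"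
  by (simp add: eval_nat_numeral)

text \<open>Since \<open>\<alpha>\<close> has order \<open>N\<close>, \<open>z\<close> has order
  exactly \<open>k\<close>; a root written as a power of \<open>\<alpha>\<close> must have an
  exponent divisible by \<open>N div k\<close>.\<close>

lemma (in primitive_element) roots_of_unity:
  assumes "k > 0" "k dvd N"
  defines "z \<equiv> \<alpha> ^ (N div k)"
  shows "{x. x ^ k = 1} = (\<lambda>i. z ^ i) ` {..<k}" "inj_on (\<lambda>i. z ^ i) {..<k}" "z ^ k = 1"
proof -
  have N: "N = k * (N div k)" using assms(2) by simp
  then have pos: "N div k > 0" using N_pos by (metis gr0I mult_0_right less_irrefl)
  have z_eq_1: "z ^ i = 1 \<longleftrightarrow> k dvd i" for i
  proof -
    have "z ^ i = 1 \<longleftrightarrow> k * (N div k) dvd i * (N div k)"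
      using N by (simp only: z_def power_eq_1_iff flip: power_mult) (simp add: mult.commute)
    then show ?thesis using pos by simp
  qed
  then show zk: "z ^ k = 1" by simp
  have z0: "z \<noteq> 0" by (simp add: z_def)
  show "inj_on (\<lambda>i. z ^ i) {..<k}"
  proof (rule linorder_inj_onI)
    fix i j assume ij: "i < j" "i \<in> {..<k}" "j \<in> {..<k}"
    have "z ^ j = z ^ i * z ^ (j - i)" using ij by (simp flip: power_add)
    then show "z ^ i \<noteq> z ^ j"
      using ij z0 z_eq_1[of "j - i"] by (auto dest!: dvd_imp_le)
  qed auto
  show "{x. x ^ k = 1} = (\<lambda>i. z ^ i) ` {..<k}"
  proof (intro equalityI subsetI)
    fix x :: 'a assume "x \<in> {x. x ^ k = 1}"
    then have x: "x ^ k = 1" by simp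
    then have "x \<noteq> 0" using assms(1) by (auto simp: zero_power)
    then obtain n where n: "x = \<alpha> ^ n" by (rule powerE)
    then have "\<alpha> ^ (n * k) = 1" using x by (simp add: power_mult)
    then have "k * (N div k) dvd k * n" using N by (simp only: power_eq_1_iff) (simp add: mult.commute)
    then obtain m where "n = (N div k) * m" using assms(1) by (auto elim: dvdE)
    then have "x = z ^ m" using n by (simp add: z_def power_mult)
    also have "z ^ m = z ^ (k * (m div k) + m mod k)" by simp
    also have "\<dots> = z ^ (m mod k)"
      by (simp only: power_add power_mult zk) simp
    finally show "x \<in> (\<lambda>i. z ^ i) ` {..<k}" using assms(1) by auto
  next
    fix x assume "x \<in> (\<lambda>i. z ^ i) ` {..<k}"
    then obtain i where "x = z ^ i" by auto
    then have "x ^ k = (z ^ k) ^ i" by (simp only: power_mult[symmetric] mult.commute)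
    then show "x \<in> {x. x ^ k = 1}" using zk by simp
  qed
qed

section \<open>Characters of the differences of tenth roots of unity\<close>

locale twenty_dvd = primitive_element +
  assumes twenty: "20 dvd N"
begin

text \<open>A primitive tenth root of unity with square \<open>\<beta>\<close> and fifth power -1.
  As 20 divides \<open>N\<close>, the exponent is even, so all powers of \<open>\<zeta>\<close>, -1
  among them, are squares.\<close>

definition "\<zeta> = \<alpha> ^ (N div 10)"

lemma zeta_2: "\<zeta> ^ 2 = \<alpha> ^ (N div 5)"
  using twenty by (auto simp: \<zeta>_def simp flip: power_mult elim!: dvdE)

lemma ten_dvd: "10 dvd N" and five_dvd: "5 dvd N"
  using twenty by (auto elim!: dvdE)

lemma zeta_10: "\<zeta> ^ 10 = 1"
  unfolding \<zeta>_def using roots_of_unity(3)[of 10] ten_dvd by simp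

lemma zeta_ne: "\<zeta> ^ 5 \<noteq> 1" "\<zeta> ^ 2 \<noteq> 1" "\<zeta> \<noteq> 0"
proof -
  have inj: "inj_on (\<lambda>i. \<zeta> ^ i) {..<10}"
    unfolding \<zeta>_def using roots_of_unity(2)[of 10] ten_dvd by simp
  show "\<zeta> ^ 5 \<noteq> 1" using inj_onD[OF inj, of 5 0] by auto
  show "\<zeta> ^ 2 \<noteq> 1" using inj_onD[OF inj, of 2 0] by auto
  show "\<zeta> \<noteq> 0" by (simp add: \<zeta>_def)
qed

lemma zeta_5: "\<zeta> ^ 5 = -1"
proof -
  have "(\<zeta> ^ 5) ^ 2 = 1" using zeta_10 by (simp flip: power_mult)
  then show ?thesis using zeta_ne(1) power2_eq_1_iff[of "\<zeta> ^ 5"] by blast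
qed

lemma two_ne_0: "(2::'a) \<noteq> 0"
proof
  assume "(2::'a) = 0"
  then have "(-1::'a) = 1" by (simp add: eq_neg_iff_add_eq_0 one_add_one)
  then show False using zeta_5 zeta_ne(1) by simp
qed

text \<open>The tenth cyclotomic polynomial at \<open>\<zeta>\<close>: the factor
  \<open>1 + \<zeta>\<close> is cancelled from \<open>1 + \<zeta> ^ 5 = 0\<close>.\<close>

lemma cyclotomic: "1 - \<zeta> + \<zeta>^2 - \<zeta>^3 + \<zeta>^4 = 0"
proof -
  have "(1 + \<zeta>) * (1 - \<zeta> + \<zeta>^2 - \<zeta>^3 + \<zeta>^4) = 1 + \<zeta> ^ 5"
    by (simp add: algebra_simps eval_nat_numeral)
  moreover have "1 + \<zeta> \<noteq> 0" using zeta_ne(2)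
    by (metis add.inverse_inverse add_eq_0_iff one_power2 power2_minus)
  ultimately show ?thesis using zeta_5 by simp
qed

lemma qchi_zeta_power: "qchi (\<zeta> ^ i) = 1"
proof -
  have "even (N div 10)" using twenty by (auto elim!: dvdE)
  then show ?thesis by (simp add: \<zeta>_def qchi_power flip: power_mult)
qed

lemma qchi_zeta: "qchi \<zeta> = 1"
  using qchi_zeta_power[of 1] by simp

lemma qchi_uminus: "qchi (- x :: 'a) = qchi x"
  using qchi_mult[of "-1" x] qchi_zeta_power[of 5] by (simp add: zeta_5)

lemma qchi_diff_commute: "qchi (x - y :: 'a) = qchi (y - x)"
  using qchi_uminus[of "x - y"] by simp

text \<open>The sign in condition (iii). Every other condition is shown equivalent to
  \<open>\<sigma> = -1\<close>, (vi) and (vii) for prime \<open>q\<close>.\<close>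

definition "\<sigma> = qchi (1 + \<zeta> ^ 2)"

lemma qchi_1_minus_zeta: "qchi (1 - \<zeta>) = \<sigma>" and sigma_cases: "\<sigma> = 1 \<or> \<sigma> = -1"
proof -
  \<comment> \<open>By the cyclotomic relation the product is a nonzero square, so both factors are
    nonzero and have equal character.\<close>
  have "(1 + \<zeta>^2) * (1 - \<zeta>) = - (\<zeta> ^ 4)"
    using cyclotomic by (simp add: algebra_simps eval_nat_numeral) algebra
  then have *: "\<sigma> * qchi (1 - \<zeta>) = 1"
    by (simp add: \<sigma>_def qchi_uminus qchi_zeta_power flip: qchi_mult)
  then have "1 + \<zeta> ^ 2 \<noteq> 0" by (auto simp: \<sigma>_def)
  then show vc: "\<sigma> = 1 \<or> \<sigma> = -1" unfolding \<sigma>_def by (rule qchi_cases)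
  with * show "qchi (1 - \<zeta>) = \<sigma>" by auto
qed

lemma qchi_1_minus_zeta_3: "qchi (1 - \<zeta> ^ 3) = \<sigma>"
proof -
  have "1 - \<zeta> ^ 3 = \<zeta> ^ 8 * (1 + \<zeta> ^ 2)"
  proof -
    have "\<zeta> ^ 8 * (1 + \<zeta> ^ 2) = \<zeta> ^ 5 * \<zeta> ^ 3 + \<zeta> ^ 10"
      by (simp add: distrib_left flip: power_add)
    then show ?thesis by (simp only: zeta_5 zeta_10) simp
  qed
  then show ?thesis by (simp only: qchi_mult qchi_zeta_power \<sigma>_def)
qed

text \<open>Three signs remain: \<open>\<sigma>\<close>, \<open>qchi (1 - \<zeta> ^ 2)\<close> and
  \<open>qchi 2\<close>. Exponents above 5 reduce to \<open>10 - i\<close>, because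
  \<open>1 - \<zeta> ^ i\<close> and \<open>1 - \<zeta> ^ (10 - i)\<close> differ by a square
  factor.\<close>

lemma qchi_1_minus_zeta_power:
  "qchi (1 - \<zeta> ^ 4) = qchi (1 - \<zeta> ^ 2) * \<sigma>" "qchi (1 - \<zeta> ^ 5) = qchi (2::'a)"
  "qchi (1 - \<zeta> ^ 6) = qchi (1 - \<zeta> ^ 2) * \<sigma>" "qchi (1 - \<zeta> ^ 7) = \<sigma>"
  "qchi (1 - \<zeta> ^ 8) = qchi (1 - \<zeta> ^ 2)" "qchi (1 - \<zeta> ^ 9) = \<sigma>"
proof -
  have "1 - \<zeta> ^ 4 = (1 - \<zeta> ^ 2) * (1 + \<zeta> ^ 2)"
    by (simp add: algebra_simps eval_nat_numeral)
  then show 4: "qchi (1 - \<zeta> ^ 4) = qchi (1 - \<zeta> ^ 2) * \<sigma>" by (simp add: qchi_mult \<sigma>_def)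
  show "qchi (1 - \<zeta> ^ 5) = qchi (2::'a)" by (simp add: zeta_5)
  have *: "qchi (1 - \<zeta> ^ i) = qchi (1 - \<zeta> ^ (10 - i))" if "i \<le> 10" for i
  proof -
    have "\<zeta> ^ (10 - i) * \<zeta> ^ i = 1" using that zeta_10 by (simp flip: power_add)
    then have "1 - \<zeta> ^ (10 - i) = \<zeta> ^ (10 - i) * - (1 - \<zeta> ^ i)"
      by (simp add: algebra_simps)
    then show ?thesis by (simp only: qchi_mult qchi_zeta_power qchi_uminus)
  qed
  show "qchi (1 - \<zeta> ^ 6) = qchi (1 - \<zeta> ^ 2) * \<sigma>" "qchi (1 - \<zeta> ^ 7) = \<sigma>"
    "qchi (1 - \<zeta> ^ 8) = qchi (1 - \<zeta> ^ 2)" "qchi (1 - \<zeta> ^ 9) = \<sigma>"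
    using *[of 6] *[of 7] *[of 8] *[of 9] 4 qchi_1_minus_zeta qchi_1_minus_zeta_3 by simp_all
qed

text \<open>Rotating a triple by an element of the subgroup does not change its type, so the first
  point may be taken to be 1.\<close>

lemma gives_3design_iff_sum:
  assumes k: "3 \<le> k" "k dvd N" and z: "z = \<alpha> ^ (N div k)" and sq: "\<And>i. qchi (z ^ i) = 1"
  shows "gives_3design TYPE('a) k \<longleftrightarrow>
    (\<Sum>i<k. \<Sum>j<k. qchi (1 - z ^ i) * qchi (1 - z ^ (if i \<le> j then j - i else i - j)) *
      qchi (1 - z ^ j)) = 0"
proof -
  define B where "B = {x::'a. x ^ k = 1}"
  have B: "B = (\<lambda>i. z ^ i) ` {..<k}" "inj_on (\<lambda>i. z ^ i) {..<k}"
    using roots_of_unity[of k] k by (simp_all add: B_def z)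
  have cardB: "card B = k" using B by (simp add: card_image)
  have B_ne_0: "a \<noteq> 0" if "a \<in> B" for a
    using that k by (auto simp: B_def zero_power)
  have sqB: "qchi a = 1" if "a \<in> B" for a
    using that sq by (auto simp: B)
  define S where "S = (\<Sum>(b, c)\<in>B \<times> B. qchi (1 - b) * qchi (b - c) * qchi (c - 1))"
  have *: "(\<Sum>(b, c)\<in>B \<times> B. qchi (a - b) * qchi (b - c) * qchi (c - a)) = S" if a: "a \<in> B" for a
    unfolding S_def
  proof (rule sum.reindex_bij_witness[of _ "\<lambda>(b, c). (a * b, a * c)" "\<lambda>(b, c). (b / a, c / a)"])
    fix t assume "t \<in> B \<times> B"
    then obtain b c where t: "t = (b, c)" "b \<in> B" "c \<in> B" by auto
    show "(case t of (b, c) \<Rightarrow> (b / a, c / a)) \<in> B \<times> B"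
      using t a by (simp add: B_def power_divide)
    show "(case t of (b, c) \<Rightarrow> (a * b, a * c)) \<in> B \<times> B"
      using t a by (simp add: B_def power_mult_distrib)
    have scale: "qchi (x / a - y / a) = qchi (x - y)" for x y
      using qchi_mult[of a "x / a - y / a"] sqB[OF a] B_ne_0[OF a]
      by (simp add: right_diff_distrib)
    show "(case case t of (b, c) \<Rightarrow> (b / a, c / a) of
      (b, c) \<Rightarrow> qchi (1 - b) * qchi (b - c) * qchi (c - 1)) =
      (case t of (b, c) \<Rightarrow> qchi (a - b) * qchi (b - c) * qchi (c - a))"
      using scale[of a b] scale[of b c] scale[of c a] B_ne_0[OF a] by (simp add: t)
  qed (use B_ne_0[OF a] in auto)
  have "(\<Sum>(a, b, c)\<in>B \<times> B \<times> B. qchi (a - b) * qchi (b - c) * qchi (c - a)) = int k * S"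
  proof -
    have "(\<Sum>(a, b, c)\<in>B \<times> B \<times> B. qchi (a - b) * qchi (b - c) * qchi (c - a)) =
      (\<Sum>a\<in>B. \<Sum>(b, c)\<in>B \<times> B. qchi (a - b) * qchi (b - c) * qchi (c - a))"
      by (rule sum.cartesian_product[symmetric])
    with * show ?thesis by (simp add: cardB)
  qed
  moreover have "S = (\<Sum>i<k. \<Sum>j<k. qchi (1 - z ^ i) *
    qchi (1 - z ^ (if i \<le> j then j - i else i - j)) * qchi (1 - z ^ j))"
  proof -
    \<comment> \<open>Powers of \<open>z\<close> and -1 are squares, so only the absolute difference
      of the exponents matters; the case distinction expresses it in the naturals.\<close>
    have diff: "qchi (z ^ i - z ^ j) = qchi (1 - z ^ (if i \<le> j then j - i else i - j))" for i j
    proof -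
      have *: "qchi (z ^ i - z ^ j) = qchi (1 - z ^ (j - i))" if "i \<le> j" for i j
      proof -
        have "z ^ i - z ^ j = z ^ i * (1 - z ^ (j - i))"
          using that by (simp add: right_diff_distrib flip: power_add)
        then show ?thesis by (simp only: qchi_mult sq)
      qed
      show ?thesis using *[of i j] *[of j i] qchi_diff_commute[of "z ^ i"] by auto
    qed
    show ?thesis
      unfolding S_def by (simp add: B(1) sum.reindex[OF B(2)] diff qchi_diff_commute[of _ 1]
        flip: sum.cartesian_product)
  qed
  ultimately show ?thesis
    using starter_3design_iff_sum[of B] k cardB unfolding gives_3design_def B_def by simp
qed

section \<open>Evaluation of the character sums for the subgroups of order 10 and 5\<close>

lemma qchi_2_cases: "qchi (2::'a) = 1 \<or> qchi (2::'a) = -1"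
  using two_ne_0 by (rule qchi_cases)

lemma qchi_1_minus_zeta_2_cases: "qchi (1 - \<zeta> ^ 2) = 1 \<or> qchi (1 - \<zeta> ^ 2) = -1"
  using zeta_ne(2) by (intro qchi_cases) simp

lemma gives_3design_10: "gives_3design TYPE('a) 10 \<longleftrightarrow> \<sigma> = -1"
proof -
  define F where "F i = qchi (1 - \<zeta> ^ i)" for i
  have F: "F 0 = 0" "F (Suc 0) = \<sigma>" "F 3 = \<sigma>" "F 4 = F 2 * \<sigma>" "F 5 = qchi (2::'a)" "F 6 = F 2 * \<sigma>"
    "F 7 = \<sigma>" "F 8 = F 2" "F 9 = \<sigma>"
    using qchi_1_minus_zeta qchi_1_minus_zeta_3 qchi_1_minus_zeta_power by (simp_all add: F_def)
  have "gives_3design TYPE('a) 10 \<longleftrightarrow>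
    (\<Sum>i<10. \<Sum>j<10. F i * F (if i \<le> j then j - i else i - j) * F j) = 0"
    unfolding F_def using ten_dvd qchi_zeta_power by (intro gives_3design_iff_sum) (simp_all add: \<zeta>_def)
  \<comment> \<open>Computed for each of the eight sign patterns. The factor
    \<open>2 + qchi 2\<close> is 1 or 3, so the value is nonzero when
    \<open>\<sigma> = 1\<close>.\<close>
  also have "(\<Sum>i<10. \<Sum>j<10. F i * F (if i \<le> j then j - i else i - j) * F j) =
    (if \<sigma> = -1 then 0 else 24 * F 2 * (2 + qchi (2::'a)))"
    using sigma_cases qchi_2_cases qchi_1_minus_zeta_2_cases[folded F_def]
    unfolding sum_lessThan_10 by (elim disjE) (simp_all add: F)
  also have "\<dots> = 0 \<longleftrightarrow> \<sigma> = -1"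
    using qchi_2_cases qchi_1_minus_zeta_2_cases[folded F_def] by auto
  finally show ?thesis .
qed

text \<open>\<open>F\<close> takes one value at 1 and 4, and \<open>\<sigma>\<close> times that
  value at 2 and 3. For \<open>\<sigma> = 1\<close> the 12 nonzero terms agree; for
  \<open>\<sigma> = -1\<close> triples with differences 1, 1, 2 (modulo 5, up to sign) cancel those
  with 1, 2, 2.\<close>

lemma gives_3design_5: "gives_3design TYPE('a) 5 \<longleftrightarrow> \<sigma> = -1"
proof -
  define F where "F i = qchi (1 - (\<zeta> ^ 2) ^ i)" for i
  have F: "F 0 = 0" "F 2 = F (Suc 0) * \<sigma>" "F 3 = F (Suc 0) * \<sigma>" "F 4 = F (Suc 0)"
    using qchi_1_minus_zeta_power by (simp_all add: F_def flip: power_mult)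
  have F1: "F (Suc 0) = 1 \<or> F (Suc 0) = -1"
    using qchi_1_minus_zeta_2_cases by (simp add: F_def)
  have "qchi ((\<zeta> ^ 2) ^ i) = 1" for i
    using qchi_zeta_power by (simp flip: power_mult)
  then have "gives_3design TYPE('a) 5 \<longleftrightarrow>
    (\<Sum>i<5. \<Sum>j<5. F i * F (if i \<le> j then j - i else i - j) * F j) = 0"
    unfolding F_def using five_dvd by (intro gives_3design_iff_sum) (simp_all add: zeta_2[symmetric] del: power_Suc)
  also have "(\<Sum>i<5. \<Sum>j<5. F i * F (if i \<le> j then j - i else i - j) * F j) =
    (if \<sigma> = -1 then 0 else 12 * F (Suc 0))"
    using sigma_cases F1
    unfolding sum_lessThan_5 by (elim disjE) (simp_all add: F)
  also have "\<dots> = 0 \<longleftrightarrow> \<sigma> = -1"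
    using F1 by auto
  finally show ?thesis .
qed

text \<open>With \<open>\<beta> = \<zeta> ^ 2\<close> these are the Gaussian periods \<open>\<beta> + \<beta> ^ 4\<close> and \<open>\<beta> ^ 2 + \<beta> ^ 3\<close>. They differ by a
  square root of 5, and their cubes are the negatives of the roots of \<open>X ^ 2 - 4 * X - 1\<close>.\<close>

lemma periods:
  obtains e e' where "e + e' = (-1::'a)" "e * e' = -1" "qchi e = \<sigma>" "qchi e' = \<sigma>"
    "e - e' = \<zeta> * (1 + \<zeta>) ^ 2 * (1 - \<zeta>)"
proof
  let ?e = "\<zeta> ^ 2 * (1 - \<zeta>)" and ?e' = "- (\<zeta> * (1 - \<zeta> ^ 3))"
  have "?e + ?e' = (1 - \<zeta> + \<zeta>^2 - \<zeta>^3 + \<zeta>^4) - 1"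
    by (simp add: algebra_simps eval_nat_numeral)
  then show "?e + ?e' = -1" by (simp add: cyclotomic)
  have "?e * ?e' = \<zeta> ^ 4 - \<zeta> ^ 3 + \<zeta> ^ 5 * \<zeta> - \<zeta> ^ 5 * \<zeta> ^ 2"
    by (simp add: algebra_simps eval_nat_numeral)
  also have "\<dots> = (1 - \<zeta> + \<zeta>^2 - \<zeta>^3 + \<zeta>^4) - 1"
    by (simp add: zeta_5)
  finally show "?e * ?e' = -1" by (simp add: cyclotomic)
  show "qchi ?e = \<sigma>" "qchi ?e' = \<sigma>"
    by (simp_all add: qchi_uminus qchi_mult qchi_zeta_power qchi_zeta qchi_1_minus_zeta
        qchi_1_minus_zeta_3)
  show "?e - ?e' = \<zeta> * (1 + \<zeta>) ^ 2 * (1 - \<zeta>)"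
    by (simp add: algebra_simps eval_nat_numeral)
qed

text \<open>A root must be the negated cube of a period, and cubing keeps the sign. Both roots thus
  share one character, which settles the existential in (iv).\<close>

lemma qchi_theta:
  assumes "\<theta> ^ 2 - 4 * \<theta> - 1 = (0::'a)"
  shows "qchi \<theta> = \<sigma>"
proof -
  obtain e e' where e: "e + e' = (-1::'a)" "e * e' = -1" "qchi e = \<sigma>" "qchi e' = \<sigma>"
    by (rule periods)
  have "e ^ 3 + e' ^ 3 = (e + e') * ((e + e') ^ 2 - 3 * (e * e'))"
    by (simp add: algebra_simps eval_nat_numeral)
  then have "e ^ 3 + e' ^ 3 = -4" by (simp add: e)
  moreover have "e ^ 3 * e' ^ 3 = -1" by (simp add: e flip: power_mult_distrib)
  moreover have "(\<theta> + e ^ 3) * (\<theta> + e' ^ 3) = \<theta> ^ 2 + \<theta> * (e ^ 3 + e' ^ 3) + e ^ 3 * e' ^ 3"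
    by (simp add: algebra_simps power2_eq_square)
  ultimately have "(\<theta> + e ^ 3) * (\<theta> + e' ^ 3) = 0"
    using assms by (simp add: mult.commute)
  then have "\<theta> = - (e ^ 3) \<or> \<theta> = - (e' ^ 3)"
    by (simp add: eq_neg_iff_add_eq_0)
  then have "qchi \<theta> = \<sigma> * \<sigma> * \<sigma>"
    by (auto simp: qchi_uminus qchi_mult power3_eq_cube e)
  then show ?thesis using sigma_cases by auto
qed

text \<open>The difference of the periods has square \<open>(-1) ^ 2 - 4 * (-1)\<close>; in its
  product form every factor except \<open>1 - \<zeta>\<close> is a square.\<close>

lemma sqrt_5:
  obtains s :: 'a where "s ^ 2 = 5" "qchi s = \<sigma>" "s \<noteq> 0"
proof
  let ?s = "\<zeta> * (1 + \<zeta>) ^ 2 * (1 - \<zeta>)"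
  obtain e e' where e: "e + e' = (-1::'a)" "e * e' = -1" "e - e' = ?s"
    by (rule periods)
  have "(e - e') ^ 2 = (e + e') ^ 2 - 4 * (e * e')"
    by (simp add: algebra_simps power2_eq_square)
  then show "?s ^ 2 = 5" unfolding e by simp
  have "1 + \<zeta> \<noteq> 0" "1 - \<zeta> \<noteq> 0"
    using zeta_ne(2) power2_eq_1_iff[of \<zeta>] by (auto simp: add_eq_0_iff)
  then show "?s \<noteq> 0" "qchi ?s = \<sigma>"
    using zeta_ne by (simp_all add: qchi_mult qchi_sq qchi_zeta qchi_1_minus_zeta)
qed

lemma ex_theta_iff:
  "(\<exists>\<theta>::'a. \<theta> \<noteq> 0 \<and> qchi \<theta> = -1 \<and> \<theta> ^ 2 - 4 * \<theta> - 1 = 0) \<longleftrightarrow> \<sigma> = -1"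
proof
  assume \<sigma>: "\<sigma> = -1"
  obtain s :: 'a where s: "s ^ 2 = 5" by (rule sqrt_5)
  \<comment> \<open>Completing the square turns the equation for \<open>\<theta>\<close> into
    \<open>(\<theta> - 2) ^ 2 = 5\<close>.\<close>
  have "(2 + s) ^ 2 - 4 * (2 + s) - 1 = s ^ 2 - 5"
    by (simp add: algebra_simps power2_eq_square)
  then have *: "(2 + s) ^ 2 - 4 * (2 + s) - 1 = 0" by (simp add: s)
  then have "qchi (2 + s) = -1" using \<sigma> by (simp add: qchi_theta)
  moreover from this have "2 + s \<noteq> 0" by (auto simp del: qchi_eq_0_iff simp: qchi_def)
  ultimately show "\<exists>\<theta>::'a. \<theta> \<noteq> 0 \<and> qchi \<theta> = -1 \<and> \<theta> ^ 2 - 4 * \<theta> - 1 = 0" using * by blast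
qed (metis qchi_theta)

text \<open>Since \<open>5 = s ^ 2\<close> and -1 is a square, 5 is a fourth power exactly when
  \<open>s\<close> is a square.\<close>

lemma five_fourth_power_iff: "(\<exists>n::nat. (of_nat 5 :: 'a) = (\<alpha> ^ 4) ^ n) \<longleftrightarrow> \<sigma> \<noteq> -1"
proof -
  obtain s :: 'a where s: "s ^ 2 = 5" "qchi s = \<sigma>" "s \<noteq> 0" by (rule sqrt_5)
  then obtain m where m: "s = \<alpha> ^ m" by (metis powerE)
  have "(\<exists>n::nat. (of_nat 5 :: 'a) = (\<alpha> ^ 4) ^ n) \<longleftrightarrow> (\<exists>n. s ^ 2 = (\<alpha> ^ (2 * n)) ^ 2)"
    by (simp add: s(1) mult.commute flip: power_mult)
  also have "\<dots> \<longleftrightarrow> \<sigma> \<noteq> -1"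
  proof
    assume "\<exists>n. s ^ 2 = (\<alpha> ^ (2 * n)) ^ 2"
    then obtain n where "s = \<alpha> ^ (2 * n) \<or> s = - (\<alpha> ^ (2 * n))"
      by (auto simp: power2_eq_iff)
    then have "qchi s = qchi (\<alpha> ^ (2 * n))" by (auto simp: qchi_uminus)
    then show "\<sigma> \<noteq> -1" unfolding qchi_power using s by simp
  next
    assume "\<sigma> \<noteq> -1"
    then have "even m" using s(2) qchi_power[of m] unfolding m by presburger
    then show "\<exists>n. s ^ 2 = (\<alpha> ^ (2 * n)) ^ 2" by (auto simp: m elim!: evenE)
  qed
  finally show ?thesis .
qed

end

section \<open>Representations of primes by quadratic forms\<close>

text \<open>Pigeonhole: with \<open>m\<close> the integer square root of \<open>p\<close> there are
  \<open>(m + 1) ^ 2 > p\<close> pairs, so two of them agree in \<open>i - r * j\<close> modulo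
  \<open>p\<close>; their difference is the solution.\<close>

lemma thue:
  fixes r :: int
  assumes p: "prime (p::nat)"
  obtains x y :: int where "x \<noteq> 0 \<or> y \<noteq> 0" "x ^ 2 < int p" "y ^ 2 < int p" "int p dvd x - r * y"
proof -
  define m where "m = floor_sqrt p"
  have m_le: "m ^ 2 \<le> p" and m_gt: "p < (Suc m) ^ 2"
    by (simp_all add: m_def Suc_floor_sqrt_power2_gt)
  \<comment> \<open>A prime is not a square, which makes the bounds strict.\<close>
  have "m ^ 2 \<noteq> p" using p by (metis prime_power_iff numeral_eq_one_iff semiring_norm(85))
  with m_le have m_less: "m ^ 2 < p" by simp
  have p_pos: "p > 0" using p by (rule prime_gt_0_nat)
  define f where "f = (\<lambda>(i, j). (int i - r * int j) mod int p)"
  have "f ` ({..m} \<times> {..m}) \<subseteq> {0..<int p}"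
    using p_pos by (auto simp: f_def)
  then have "card (f ` ({..m} \<times> {..m})) \<le> p"
    using card_mono[of "{0..<int p}"] by force
  also have "p < card ({..m} \<times> {..m})"
    using m_gt by (simp add: card_cartesian_product power2_eq_square)
  finally have "\<not> inj_on f ({..m} \<times> {..m})"
    using card_image by fastforce
  then obtain i j i' j' where ij: "i \<le> m" "j \<le> m" "i' \<le> m" "j' \<le> m" "(i, j) \<noteq> (i', j')"
    "f (i, j) = f (i', j')" by (auto simp: inj_on_def)
  have bound: "(int a - int b) ^ 2 < int p" if "a \<le> m" "b \<le> m" for a b
  proof -
    have "\<bar>int a - int b\<bar> \<le> int m" using that by auto
    then have "\<bar>int a - int b\<bar> ^ 2 \<le> int m ^ 2" by (intro power_mono) auto
    also have "\<dots> = int (m ^ 2)" by simp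
    also have "\<dots> < int p" using m_less by (simp only: of_nat_less_iff)
    finally show ?thesis by simp
  qed
  show ?thesis
  proof
    show "int i - int i' \<noteq> 0 \<or> int j - int j' \<noteq> 0" using ij by auto
    show "(int i - int i') ^ 2 < int p" "(int j - int j') ^ 2 < int p" using ij bound by auto
    have "int p dvd (int i - r * int j) - (int i' - r * int j')"
      using ij(6) by (simp add: f_def mod_eq_dvd_iff)
    then show "int p dvd (int i - int i') - r * (int j - int j')"
      by (simp add: algebra_simps)
  qed
qed

text \<open>From \<open>x \<equiv> r * y\<close> follows
  \<open>x ^ 2 + d * y ^ 2 \<equiv> (r ^ 2 + d) * y ^ 2 \<equiv> 0\<close> modulo \<open>p\<close>,
  and Thue's bounds keep the form below \<open>(d + 1) * p\<close>.\<close>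

lemma small_quadratic_form:
  fixes r :: int
  assumes p: "prime (p::nat)" and r: "int p dvd r ^ 2 + int d" and d: "d > 0"
  obtains x y :: int and k :: nat where "x ^ 2 + int d * y ^ 2 = int k * int p" "1 \<le> k" "k \<le> d"
proof -
  obtain x y where xy: "x \<noteq> 0 \<or> y \<noteq> 0" "x ^ 2 < int p" "y ^ 2 < int p" "int p dvd x - r * y"
    using thue[OF p] .
  have p_pos: "p > 0" using p by (rule prime_gt_0_nat)
  have "int p dvd (x - r * y) * (x + r * y) + (r ^ 2 + int d) * y ^ 2"
    using xy(4) r by (intro dvd_add[OF dvd_mult2 dvd_mult2])
  also have "(x - r * y) * (x + r * y) + (r ^ 2 + int d) * y ^ 2 = x ^ 2 + int d * y ^ 2"
    by (simp add: algebra_simps power2_eq_square)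
  finally obtain k where k: "x ^ 2 + int d * y ^ 2 = int p * k" by (elim dvdE)
  have "x ^ 2 + int d * y ^ 2 > 0"
    using xy(1) d by (auto simp: add_pos_nonneg add_nonneg_pos)
  then have "k > 0" using p_pos unfolding k by (simp add: zero_less_mult_iff)
  have "x ^ 2 + int d * y ^ 2 < int p + int d * int p"
    using xy(2,3) d by (intro add_strict_mono mult_strict_left_mono) auto
  then have "int p * k < int p * (1 + int d)" unfolding k by (simp add: algebra_simps)
  then have "k < 1 + int d" using p_pos by simp
  then show ?thesis using that[of x y "nat k"] k \<open>k > 0\<close> by (simp add: mult.commute)
qed

lemma sum_of_two_squares:
  fixes r :: int
  assumes "prime (p::nat)" "int p dvd r ^ 2 + 1"
  obtains x y :: nat where "p = x ^ 2 + y ^ 2"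
proof -
  obtain x y :: int and k :: nat where "x ^ 2 + int 1 * y ^ 2 = int k * int p" "1 \<le> k" "k \<le> 1"
    by (rule small_quadratic_form[of p r 1]) (use assms in auto)
  then have "int p = int (nat \<bar>x\<bar> ^ 2 + nat \<bar>y\<bar> ^ 2)" by simp
  then show ?thesis using that by (metis of_nat_eq_iff)
qed

lemma square_mod_5: "(x::int) ^ 2 mod 5 \<in> {0, 1, 4}"
proof -
  have "x mod 5 \<in> {0, 1, 2, 3, 4}" by auto
  then show ?thesis by (subst power_mod[symmetric]) auto
qed

text \<open>Among the multiples \<open>k * p\<close> with \<open>k \<le> 5\<close>,
  \<open>k = 2\<close> and \<open>k = 3\<close> fail modulo 5, \<open>k = 4\<close> forces both
  variables even, and for \<open>k = 5\<close> division by 5 exchanges the variables.\<close>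

lemma prime_eq_x2_5y2:
  fixes r :: int
  assumes p: "prime (p::nat)" "p mod 20 = 1" and r: "int p dvd r ^ 2 + 5"
  obtains x y :: nat where "p = x ^ 2 + 5 * y ^ 2"
proof -
  have "\<exists>x y :: int. int p = x ^ 2 + 5 * y ^ 2"
  proof -
    obtain x y :: int and k :: nat where k: "x ^ 2 + int 5 * y ^ 2 = int k * int p" "1 \<le> k" "k \<le> 5"
      by (rule small_quadratic_form[of p r 5]) (use assms in auto)
    have "int p mod 5 = 1" "int p mod 4 = 1" using p(2) by presburger+
    have "x ^ 2 mod 5 = (x ^ 2 + int 5 * y ^ 2) mod 5" by simp
    also have "\<dots> = int k * (int p mod 5) mod 5" unfolding k(1) by (simp add: mod_mult_right_eq)
    finally have "x ^ 2 mod 5 = int k mod 5" using \<open>int p mod 5 = 1\<close> by simp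
    then have "int k mod 5 \<in> {0, 1, 4}" "k = 5 \<Longrightarrow> x ^ 2 mod 5 = 0"
      using square_mod_5[of x] by simp_all
    moreover have "k = 1 \<or> k = 2 \<or> k = 3 \<or> k = 4 \<or> k = 5" using k(2,3) by linarith
    ultimately consider "k = 1" | "k = 4" | "k = 5" "x ^ 2 mod 5 = 0"
      by (elim disjE) simp_all
    then show ?thesis
    proof cases
      case 1
      then show ?thesis using k(1) by (intro exI[of _ x] exI[of _ y]) simp
    next
      case 2
      then have eq: "x ^ 2 + 5 * y ^ 2 = 4 * int p" using k(1) by simp
      have parity: "even x \<longleftrightarrow> even y"
      proof -
        have "even (x ^ 2 + 5 * y ^ 2)" unfolding eq by simp
        then show ?thesis by simp
      qed
      show ?thesis
      proof (cases "even x")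
        case True
        then obtain x' y' where "x = 2 * x'" "y = 2 * y'" using parity by (auto elim!: evenE)
        then have "int p = x' ^ 2 + 5 * y' ^ 2" using eq by simp
        then show ?thesis by blast
      next
        case False
        have odd_sq: "z ^ 2 mod 8 = 1" if "odd z" for z :: int
        proof -
          from that have "z mod 8 = 1 \<or> z mod 8 = 3 \<or> z mod 8 = 5 \<or> z mod 8 = 7" by presburger
          then have "(z mod 8) ^ 2 mod 8 = 1" by (elim disjE) simp_all
          then show ?thesis by (simp only: power_mod)
        qed
        \<comment> \<open>With both variables odd the form would be 6 modulo 8.\<close>
        have "4 * int p mod 8 = 4" using \<open>int p mod 4 = 1\<close> by presburger
        moreover have "x ^ 2 mod 8 = 1" "y ^ 2 mod 8 = 1" using odd_sq False parity by auto
        moreover have False if "a mod 8 = 1" "b mod 8 = 1" "a + 5 * b = c" "c mod 8 = 4" for a b c :: int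
          using that by presburger
        ultimately show ?thesis using eq by blast
      qed
    next
      case 3
      then have "5 dvd x" using prime_dvd_power[of "5::int" x 2] by auto
      then obtain x' where "x = 5 * x'" by (elim dvdE)
      then have "int p = y ^ 2 + 5 * x' ^ 2" using k(1) 3(1) by (simp add: power_mult_distrib)
      then show ?thesis by blast
    qed
  qed
  then obtain x y where "int p = x ^ 2 + 5 * y ^ 2" by blast
  then have "int p = int (nat \<bar>x\<bar> ^ 2 + 5 * nat \<bar>y\<bar> ^ 2)" by simp
  then show ?thesis using that by (metis of_nat_eq_iff)
qed

section \<open>From primes to composite arguments: multiplicative functions, residues and
  reciprocity\<close>

lemma multiplicative_eq:
  fixes f g :: "nat \<Rightarrow> int"
  assumes "f 1 = g 1" "\<And>a b. f (a * b) = f a * f b" "\<And>a b. g (a * b) = g a * g b"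
    and "n > 0" "\<And>l. prime l \<Longrightarrow> l dvd n \<Longrightarrow> f l = g l"
  shows "f n = g n"
  using assms(4,5)
proof (induction n rule: prime_divisors_induct)
  case (factor l n)
  then have "f n = g n" by (metis dvd_mult mult_0_right not_gr0)
  moreover have "f l = g l" using factor by simp
  ultimately show ?case by (simp add: assms(2,3))
qed (use assms(1) in auto)

text \<open>The Legendre symbol modulo 5, tabulated by residues so that it can be evaluated by
  cases.\<close>

definition chi5 :: "nat \<Rightarrow> int" where
  "chi5 n = (if n mod 5 = 0 then 0 else if n mod 5 = 1 \<or> n mod 5 = 4 then 1 else -1)"

lemma chi5_mult: "chi5 (a * b) = chi5 a * chi5 b"
proof -
  have red: "chi5 n = chi5 (n mod 5)" for n by (simp add: chi5_def)
  have cases: "n mod 5 = 0 \<or> n mod 5 = 1 \<or> n mod 5 = 2 \<or> n mod 5 = 3 \<or> n mod 5 = 4" for n :: nat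
    by presburger
  have "chi5 (a * b) = chi5 (a mod 5 * (b mod 5))"
    using red[of "a * b"] red[of "a mod 5 * (b mod 5)"] by (simp only: mod_mult_eq)
  also have "\<dots> = chi5 (a mod 5) * chi5 (b mod 5)"
    using cases[of a] cases[of b] by (elim disjE) (simp_all add: chi5_def)
  finally show ?thesis using red[of a] red[of b] by simp
qed

lemma Legendre_5: "Legendre (int n) 5 = chi5 n"
proof -
  have "QuadRes 5 (int n)" if "n mod 5 = 1 \<or> n mod 5 = 4"
  proof -
    have "int (n mod 5) = int n mod 5" by (simp add: zmod_int)
    with that have "int n mod 5 = 1 \<or> int n mod 5 = 4" by auto
    then have "1 ^ 2 mod 5 = int n mod 5 \<or> 2 ^ 2 mod 5 = int n mod 5" by auto
    then show ?thesis unfolding QuadRes_def cong_def by metis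
  qed
  moreover have "n mod 5 = 0 \<or> n mod 5 = 1 \<or> n mod 5 = 4" if QR: "QuadRes 5 (int n)"
  proof -
    obtain y where "y ^ 2 mod 5 = int n mod 5" using QR unfolding QuadRes_def cong_def by blast
    with square_mod_5[of y] have "int n mod 5 = 0 \<or> int n mod 5 = 1 \<or> int n mod 5 = 4"
      by (simp only: insert_iff empty_iff) simp
    moreover have "int (n mod 5) = int n mod 5" by (simp add: zmod_int)
    ultimately show ?thesis by linarith
  qed
  moreover have "[int n = 0] (mod 5) \<longleftrightarrow> n mod 5 = 0"
  proof -
    have "int (n mod 5) = int n mod 5" by (simp add: zmod_int)
    then have "int n mod 5 = 0 \<longleftrightarrow> n mod 5 = 0" by linarith
    then show ?thesis by (simp only: cong_def mod_0)
  qed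
  ultimately show ?thesis unfolding Legendre_def chi5_def by auto
qed

text \<open>If \<open>z\<close> is a square root of \<open>x\<close> modulo \<open>l\<close>, then
  \<open>c * z / d\<close> is one of \<open>y\<close>.\<close>

lemma QuadRes_square_multiple:
  assumes "QuadRes l x" "[c ^ 2 * x = d ^ 2 * y] (mod l)" "coprime d l"
  shows "QuadRes l y"
proof -
  obtain z where z: "[z ^ 2 = x] (mod l)" using assms(1) by (auto simp: QuadRes_def)
  obtain d' where d': "[d * d' = 1] (mod l)" using assms(3) cong_solve_coprime_int by blast
  have "[(c * z * d') ^ 2 = c ^ 2 * z ^ 2 * d' ^ 2] (mod l)"
    by (simp add: power_mult_distrib)
  also have "[c ^ 2 * z ^ 2 * d' ^ 2 = c ^ 2 * x * d' ^ 2] (mod l)"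
    using z by (intro cong_mult cong_refl)
  also have "[c ^ 2 * x * d' ^ 2 = d ^ 2 * y * d' ^ 2] (mod l)"
    using assms(2) by (rule cong_mult) (rule cong_refl)
  also have "d ^ 2 * y * d' ^ 2 = y * (d * d') ^ 2"
    by (simp add: power_mult_distrib)
  also have "[y * (d * d') ^ 2 = y * 1 ^ 2] (mod l)"
    using d' by (intro cong_mult cong_pow cong_refl)
  finally show ?thesis unfolding QuadRes_def by auto
qed

lemma Legendre_eq:
  assumes "[c ^ 2 * x = d ^ 2 * y] (mod l)" "coprime c l" "coprime d l"
  shows "Legendre x l = Legendre y l"
proof -
  have "[c ^ 2 * x = 0] (mod l) \<longleftrightarrow> [d ^ 2 * y = 0] (mod l)"
    using assms(1) cong_sym cong_trans by blast
  then have "[x = 0] (mod l) \<longleftrightarrow> [y = 0] (mod l)"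
    using assms(2,3) by (simp add: cong_0_iff coprime_dvd_mult_right_iff coprime_commute)
  moreover have "QuadRes l x \<longleftrightarrow> QuadRes l y"
    using QuadRes_square_multiple assms cong_sym by metis
  ultimately show ?thesis by (simp add: Legendre_def)
qed

lemma Quadratic_Reciprocity_1_mod_4:
  assumes "prime (p::nat)" "p mod 4 = 1" "prime (l::nat)" "odd l" "l \<noteq> p"
  shows "Legendre (int l) (int p) = Legendre (int p) (int l)"
proof -
  have "p > 2" "l > 2" using assms prime_ge_2_nat[of p] prime_ge_2_nat[of l]
    by (auto simp: le_less)
  then have "Legendre (int l) (int p) * Legendre (int p) (int l) =
    (-1) ^ ((l - 1) div 2 * ((p - 1) div 2))"
    using assms by (intro Quadratic_Reciprocity) auto
  moreover have "even ((p - 1) div 2)" using assms(2) by presburger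
  ultimately have "Legendre (int l) (int p) * Legendre (int p) (int l) = 1" by simp
  then show ?thesis unfolding Legendre_def by (auto split: if_splits)
qed

lemma odd_square_mod_8: "odd n \<Longrightarrow> n ^ 2 mod 8 = (1::nat)"
proof -
  assume "odd n"
  then have "n mod 8 = 1 \<or> n mod 8 = 3 \<or> n mod 8 = 5 \<or> n mod 8 = 7" by presburger
  then have "(n mod 8) ^ 2 mod 8 = 1" by (elim disjE) simp_all
  then show ?thesis by (simp only: power_mod)
qed

lemma odd_part:
  assumes "n > (0::nat)" obtains r m where "n = 2 ^ r * m" "odd m"
proof -
  have "\<exists>r m. n = 2 ^ r * m \<and> odd m"
    using assms
  proof (induction n rule: less_induct)
    case (less n)
    show ?case
    proof (cases "even n")
      case True
      then obtain k where k: "n = 2 * k" by (elim evenE)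
      then obtain r m where "k = 2 ^ r * m" "odd m" using less.IH[of k] less.prems by auto
      then have "n = 2 ^ Suc r * m" using k by simp
      with \<open>odd m\<close> show ?thesis by blast
    next
      case False
      then show ?thesis by (intro exI[of _ 0] exI[of _ n]) simp
    qed
  qed
  then show ?thesis using that by blast
qed

lemma mod_5_cases: "n mod 5 = 0 \<or> n mod 5 = 1 \<or> n mod 5 = 2 \<or> n mod 5 = 3 \<or> n mod 5 = (4::nat)"
  by presburger

text \<open>Two squares with sum 1 modulo 5 must be 0 and 1, so one of \<open>a\<close>,
  \<open>b\<close> vanishes modulo 5 and the other is 1 or -1.\<close>

lemma chi5_2a_b:
  assumes "(a ^ 2 + b ^ 2) mod 5 = (1::nat)"
  shows "chi5 (a + 2 * b) = (if 5 dvd b then 1 else -1)" "\<not> 5 dvd a + 2 * b"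
proof -
  have 1: "((a mod 5) ^ 2 mod 5 + (b mod 5) ^ 2 mod 5) mod 5 = 1"
    using assms by (simp only: power_mod mod_add_eq)
  have 2: "(a + 2 * b) mod 5 = (a mod 5 + 2 * (b mod 5)) mod 5"
    by (subst mod_add_right_eq[of "a mod 5" "2 * (b mod 5)", symmetric])
      (simp only: mod_mult_right_eq mod_add_eq)
  have "(a mod 5 + 2 * (b mod 5)) mod 5 \<in> (if b mod 5 = 0 then {1, 4} else {2, 3})"
    using 1 mod_5_cases[of a] mod_5_cases[of b] by (elim disjE) simp_all
  then show "chi5 (a + 2 * b) = (if 5 dvd b then 1 else -1)" "\<not> 5 dvd a + 2 * b"
    unfolding chi5_def dvd_eq_mod_eq_0 2 by (auto split: if_splits)
qed

section \<open>The character of a prime field as a Legendre symbol\<close>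

locale prime_twenty_dvd = twenty_dvd +
  assumes prime_p: "prime (Suc N)"
begin

abbreviation "p \<equiv> Suc N"

text \<open>The character pulled back to the naturals, where prime factorisation is
  available.\<close>

definition "\<psi> n = qchi (of_nat n :: 'a)"

lemma CHAR_eq_p: "CHAR('a) = p"
proof -
  have "CHAR('a) dvd p" using CHAR_dvd_CARD[where 'a = 'a] card by simp
  moreover have "CHAR('a) \<noteq> 1" using of_nat_CHAR[where 'a = 'a] by (metis of_nat_1 zero_neq_one)
  ultimately show ?thesis using prime_p by (auto simp: prime_nat_iff)
qed

lemma of_int_eq_0: "of_int m = (0::'a) \<longleftrightarrow> int p dvd m"
  using of_int_eq_0_iff_char_dvd[where 'a = 'a] by (simp add: CHAR_eq_p)

lemma of_nat_eq_0: "of_nat m = (0::'a) \<longleftrightarrow> p dvd m"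
  using of_nat_eq_0_iff_char_dvd[where 'a = 'a] by (simp add: CHAR_eq_p)

lemma of_int_eq: "of_int m = (of_int n :: 'a) \<longleftrightarrow> [m = n] (mod int p)"
  using of_int_eq_iff_cong_CHAR[where 'a = 'a] by (simp add: CHAR_eq_p)

lemma ex_of_int: "\<exists>m::int. x = (of_int m :: 'a)"
proof -
  have "inj_on (\<lambda>n. of_nat n :: 'a) {..<p}"
    by (intro inj_onI) (simp add: of_nat_eq_iff_cong_CHAR CHAR_eq_p cong_def)
  then have "card ((\<lambda>n. of_nat n :: 'a) ` {..<p}) = CARD('a)"
    by (simp add: card_image card)
  then have "(\<lambda>n. of_nat n :: 'a) ` {..<p} = UNIV"
    by (intro card_subset_eq) auto
  then obtain n :: nat where "x = of_nat n" by blast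
  then show ?thesis by (metis of_int_of_nat_eq)
qed

lemma p_mod: "p mod 20 = 1" "p mod 4 = 1" "p mod 5 = 1" "p \<noteq> 5" "p > 20" "odd p"
proof -
  obtain k where k: "N = 20 * k" using twenty by (elim dvdE)
  then show "p mod 20 = 1" "p mod 4 = 1" "p mod 5 = 1" "p \<noteq> 5" "odd p" by presburger+
  show "p > 20" using k N_pos by (cases k) auto
qed

lemma psi_mult: "\<psi> (m * n) = \<psi> m * \<psi> n"
  by (simp add: \<psi>_def qchi_mult)

lemma psi_power: "\<psi> (m ^ n) = \<psi> m ^ n"
  by (induction n) (simp_all add: psi_mult, simp add: \<psi>_def)

lemma psi_eq_Legendre: "\<psi> n = Legendre (int n) (int p)"
proof -
  have "(\<exists>y::'a. y ^ 2 = of_nat n) \<longleftrightarrow> QuadRes (int p) (int n)"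
  proof -
    have "(\<exists>y::'a. y ^ 2 = of_nat n) \<longleftrightarrow> (\<exists>m::int. (of_int m :: 'a) ^ 2 = of_int (int n))"
      using ex_of_int by (metis of_int_of_nat_eq)
    also have "\<dots> \<longleftrightarrow> QuadRes (int p) (int n)"
      unfolding QuadRes_def by (simp only: of_int_eq flip: of_int_power)
    finally show ?thesis .
  qed
  moreover have "of_nat n = (0::'a) \<longleftrightarrow> [int n = 0] (mod int p)"
    using of_int_eq[of "int n" 0] by simp
  ultimately show ?thesis unfolding \<psi>_def qchi_def Legendre_def by simp
qed

text \<open>Reciprocity replaces \<open>l\<close> modulo \<open>p\<close> by \<open>p\<close> modulo
  \<open>l\<close>, and there \<open>p\<close> is \<open>e\<close> times the square of
  \<open>d / c\<close>.\<close>

lemma psi_prime: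
  assumes "prime l" "odd l" "l \<noteq> p" "\<not> l dvd c" "\<not> l dvd d"
    and "[int c ^ 2 * int p = int d ^ 2 * e] (mod int l)"
  shows "\<psi> l = Legendre e (int l)"
proof -
  have cop: "coprime (int x) (int l)" if "\<not> l dvd x" for x
    using that assms(1) by (metis coprime_commute coprime_int_iff prime_imp_coprime)
  have "\<psi> l = Legendre (int p) (int l)"
    unfolding psi_eq_Legendre using assms(1-3) prime_p p_mod(2)
    by (intro Quadratic_Reciprocity_1_mod_4) auto
  also have "\<dots> = Legendre e (int l)"
    using assms(4-6) cop by (intro Legendre_eq)
  finally show ?thesis .
qed

text \<open>Reciprocity is used a second time, between \<open>l\<close> and 5; no sign appears
  because 5 is 1 modulo 4.\<close>

lemma psi_prime_5:
  assumes "prime l" "odd l" "l \<noteq> p" "l \<noteq> 5" "\<not> l dvd c" "\<not> l dvd d"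
    and "[int c ^ 2 * int p = int d ^ 2 * 5] (mod int l)"
  shows "\<psi> l = chi5 l"
proof -
  have "\<psi> l = Legendre 5 (int l)" using psi_prime assms by blast
  also have "\<dots> = Legendre (int l) 5"
    using Quadratic_Reciprocity_1_mod_4[of l 5] Quadratic_Reciprocity_1_mod_4[of 5 l] assms by simp
  also have "\<dots> = chi5 l" by (rule Legendre_5)
  finally show ?thesis .
qed

lemma not_dvd_square_p:
  assumes "prime l" shows "\<not> l ^ 2 dvd p"
proof
  assume *: "l ^ 2 dvd p"
  then have "l dvd p" by (metis dvd_mult_left power2_eq_square)
  then have "l = p" using assms prime_p primes_dvd_imp_eq by blast
  with * have "p ^ 2 \<le> p" by (intro dvd_imp_le) auto
  then show False using N_pos by (simp add: power2_eq_square)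
qed

lemma not_dvd_both:
  assumes "p = x ^ 2 + k * y ^ 2" "prime l" "l dvd x" shows "\<not> l dvd y"
proof
  assume "l dvd y"
  then have "l ^ 2 dvd x ^ 2 + k * y ^ 2" using assms(3) by (intro dvd_add dvd_mult) (simp_all add: dvd_power_same)
  then show False using not_dvd_square_p[OF assms(2)] assms(1) by simp
qed

lemma eq_1_if_square_dvd_p:
  assumes "z ^ 2 dvd p" shows "z = 1"
proof (rule ccontr)
  assume "z \<noteq> 1"
  then obtain l where l: "prime l" "l dvd z" using prime_factor_nat by blast
  then have "l ^ 2 dvd p" using assms by (meson dvd_power_same dvd_trans)
  then show False using not_dvd_square_p l by blast
qed

text \<open>If one variable were 0, the square of the other would divide \<open>p\<close>, so that
  variable would be 1, leaving \<open>p = k\<close> or \<open>p = 1\<close> against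
  \<open>k < 20 < p\<close>.\<close>

lemma quadratic_form_bounds:
  assumes "p = x ^ 2 + k * y ^ 2" "k > 0" "k < 20"
  shows "x > 0" "y > 0" "\<not> p dvd x" "\<not> p dvd y"
proof -
  show x: "x > 0"
  proof (rule ccontr)
    assume "\<not> x > 0"
    then have "p = k * y ^ 2" using assms(1) by simp
    moreover from this have "y = 1" using eq_1_if_square_dvd_p[of y] by simp
    ultimately show False using assms(3) p_mod(5) by simp
  qed
  show y: "y > 0"
  proof (rule ccontr)
    assume "\<not> y > 0"
    then have "p = x ^ 2" using assms(1) by simp
    moreover from this have "x = 1" using eq_1_if_square_dvd_p[of x] by simp
    ultimately show False using p_mod(5) by simp
  qed
  have "x \<le> x ^ 2" "y \<le> y ^ 2" "y ^ 2 \<le> k * y ^ 2" using assms(2) by (simp_all add: power2_eq_square)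
  moreover have "x ^ 2 > 0" "k * y ^ 2 > 0" using x y assms(2) by simp_all
  ultimately have "x < p" "y < p" using assms(1) by linarith+
  then show "\<not> p dvd x" "\<not> p dvd y" using x y by (auto dest: dvd_imp_le)
qed

text \<open>If a prime divides one of \<open>x\<close>, \<open>y\<close>, then modulo that prime the other term of
  \<open>p = x ^ 2 + k * y ^ 2\<close> is all that is left of \<open>p\<close>.\<close>

lemma psi_odd_dvd_y:
  assumes "p = x ^ 2 + k * y ^ 2" "k > 0" "k < 20" "odd m" "m dvd y"
  shows "\<psi> m = 1"
proof -
  note b = quadratic_form_bounds[OF assms(1-3)]
  have "\<psi> m = (\<lambda>n. 1) m"
  proof (rule multiplicative_eq)
    show "m > 0" using assms(4) by (auto intro: gr0I)
    fix l assume l: "prime l" "l dvd m"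
    then have ly: "l dvd y" using assms(5) dvd_trans by blast
    have "\<not> l dvd x" using not_dvd_both[OF assms(1) l(1)] ly by blast
    moreover have "\<not> l dvd 1" using l(1) by auto
    moreover have "odd l" using l(2) assms(4) dvd_trans by blast
    moreover have "l \<noteq> p" using b(4) ly by blast
    moreover have "[int 1 ^ 2 * int p = int x ^ 2 * 1] (mod int l)"
    proof -
      have "int l dvd int k * int y ^ 2" using ly by (simp add: power2_eq_square)
      then show ?thesis by (simp add: assms(1) cong_iff_dvd_diff)
    qed
    ultimately have "\<psi> l = Legendre 1 (int l)" using l(1) by (intro psi_prime)
    moreover have "QuadRes (int l) 1" by (auto simp: QuadRes_def intro: exI[of _ 1])
    moreover have "\<not> [1 = 0] (mod int l)" using l(1) by (auto simp: cong_0_iff)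
    ultimately show "\<psi> l = 1" by (simp add: Legendre_def)
  qed (simp_all add: psi_mult, simp add: \<psi>_def)
  then show ?thesis by simp
qed

lemma five_ne_0: "(5::'a) \<noteq> 0"
proof -
  have "(5::'a) = of_nat 5" by simp
  moreover have "\<not> p dvd 5" using p_mod(5) by (auto dest: dvd_imp_le)
  ultimately show ?thesis using of_nat_eq_0[of 5] by simp
qed

text \<open>\<open>2 * i\<close> is the square of \<open>1 + i\<close>.\<close>

lemma qchi_i:
  assumes "i ^ 2 = (-1::'a)" shows "qchi i = \<psi> 2"
proof -
  have sq: "(1 + i) ^ 2 = 2 * i" using assms by (simp add: power2_eq_square algebra_simps)
  have "i \<noteq> 0" using assms by auto
  then have "1 + i \<noteq> 0" using two_ne_0 sq by auto
  from qchi_sq[OF this] have "qchi (2::'a) * qchi i = 1" unfolding sq qchi_mult .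
  then show ?thesis using qchi_2_cases by (auto simp: \<psi>_def)
qed

text \<open>The supplementary law for 2, read off from the square root
  \<open>\<alpha> ^ (N div 4)\<close> of -1, whose exponent is even exactly when 8 divides
  \<open>N\<close>.\<close>

lemma psi_2: "\<psi> 2 = (if 8 dvd N then 1 else -1)"
proof -
  define i where "i = \<alpha> ^ (N div 4)"
  have "i ^ 2 = \<zeta> ^ 5"
    using twenty by (auto simp: i_def \<zeta>_def simp flip: power_mult elim!: dvdE)
  then have i2: "i ^ 2 = -1" by (simp add: zeta_5)
  have "even (N div 4) \<longleftrightarrow> 8 dvd N"
    using twenty by presburger
  then have "qchi i = (if 8 dvd N then 1 else -1)"
    by (simp add: i_def qchi_power)
  moreover have "qchi i = \<psi> 2" using qchi_i[OF i2] .
  ultimately show ?thesis by simp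
qed

lemma psi_odd_dvd_x:
  assumes "p = x ^ 2 + 5 * y ^ 2" "odd m" "m dvd x"
  shows "\<psi> m = chi5 m"
proof (rule multiplicative_eq)
  note b = quadratic_form_bounds[OF assms(1)]
  show "m > 0" using assms(2) by (auto intro: gr0I)
  fix l assume l: "prime l" "l dvd m"
  then have lx: "l dvd x" using assms(3) dvd_trans by blast
  then have "\<not> l dvd y" using not_dvd_both[OF assms(1) l(1)] by blast
  moreover have "\<not> l dvd 1" using l(1) by auto
  moreover have "odd l" using l(2) assms(2) dvd_trans by blast
  moreover have "l \<noteq> p" using b lx by auto
  moreover have "l \<noteq> 5"
  proof
    assume "l = 5"
    then have "5 dvd p" using lx unfolding assms(1) by (intro dvd_add) (simp_all add: power2_eq_square)
    then show False using p_mod(3) by presburger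
  qed
  moreover have "[int 1 ^ 2 * int p = int y ^ 2 * 5] (mod int l)"
  proof -
    have "int l dvd int x ^ 2" using lx by (simp add: power2_eq_square)
    then show ?thesis by (simp add: assms(1) cong_iff_dvd_diff)
  qed
  ultimately show "\<psi> l = chi5 l" using l(1) by (intro psi_prime_5)
qed (simp_all add: psi_mult chi5_mult, simp add: \<psi>_def chi5_def)

text \<open>Modulo a prime divisor of \<open>a + 2 * b\<close> one has
  \<open>2 * b \<equiv> - a\<close>, hence \<open>4 * p \<equiv> 5 * a ^ 2\<close>: the case
  \<open>c = 2\<close>, \<open>d = a\<close> of \<open>psi_prime_5\<close>. Oddness of
  \<open>a\<close> makes these primes odd.\<close>

lemma psi_a_2b:
  assumes p: "p = a ^ 2 + b ^ 2" "odd a"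
  shows "\<psi> (a + 2 * b) = chi5 (a + 2 * b)"
proof (rule multiplicative_eq)
  have p': "p = a ^ 2 + 1 * b ^ 2" using p by simp
  note b = quadratic_form_bounds[OF p']
  show "a + 2 * b > 0" using b(2) by simp
  fix l assume l: "prime l" "l dvd a + 2 * b"
  show "\<psi> l = chi5 l"
  proof (rule psi_prime_5[OF l(1)])
    show "odd l" using l(2) p(2) by (metis dvd_trans even_add even_mult_iff even_numeral)
    then show "\<not> l dvd 2" using l(1) by (metis even_numeral primes_dvd_imp_eq two_is_prime_nat)
    show "l \<noteq> 5" using chi5_2a_b(2)[of a b] l(2) p_mod(3) unfolding p(1) by auto
    show la: "\<not> l dvd a"
    proof
      assume "l dvd a"
      then have "l dvd 2 * b" using l(2) by (simp add: dvd_add_right_iff)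
      then have "l dvd b" using l(1) \<open>\<not> l dvd 2\<close> by (simp add: prime_dvd_mult_iff)
      then show False using not_dvd_both[OF p' l(1)] \<open>l dvd a\<close> by blast
    qed
    have *: "4 * int p - 5 * int a ^ 2 = int (a + 2 * b) * (2 * int b - int a)"
      by (simp add: p(1) algebra_simps power2_eq_square)
    then have d: "int l dvd 4 * int p - 5 * int a ^ 2" using l(2) by (simp only: dvd_mult2 int_dvd_int_iff)
    then show "[int 2 ^ 2 * int p = int a ^ 2 * 5] (mod int l)"
      by (simp add: cong_iff_dvd_diff mult.commute)
    show "l \<noteq> p"
    proof
      assume "l = p"
      then have "int p dvd 5 * int a ^ 2" using d by (metis dvd_diff_right_iff dvd_triv_right)
      then have "p dvd 5 * a ^ 2" by (metis int_dvd_int_iff of_nat_mult of_nat_numeral of_nat_power)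
      then have "p dvd 5 \<or> p dvd a" using prime_p by (auto simp: prime_dvd_mult_iff prime_dvd_power_iff)
      then show False using la \<open>l = p\<close> p_mod(5) by (auto dest: dvd_imp_le)
    qed
  qed
qed (simp_all add: psi_mult chi5_mult, simp add: \<psi>_def chi5_def)

text \<open>With \<open>s ^ 2 = 5\<close> and \<open>i = a / b\<close>, so that \<open>i ^ 2 = -1\<close>, the identity
  \<open>2 * (2 + s) * (2 + i) = (2 + s + i) ^ 2\<close> expresses the character of \<open>2 + s\<close> in terms of
  \<open>a\<close> and \<open>b\<close>.\<close>

lemma sigma_two_squares:
  assumes p: "p = a ^ 2 + b ^ 2" "odd a"
  shows "\<sigma> = (if 5 dvd b then 1 else -1)"
proof -
  \<comment> \<open>The squares are swapped so that the odd \<open>a\<close> stands where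
    \<open>psi_odd_dvd_y\<close> expects its second variable.\<close>
  have p': "p = b ^ 2 + 1 * a ^ 2" using p by simp
  note bd = quadratic_form_bounds[OF p']
  obtain s :: 'a where s: "s ^ 2 = 5" by (rule sqrt_5)
  define A B where "A = (of_nat a :: 'a)" and "B = (of_nat b :: 'a)"
  have AB: "A \<noteq> 0" "B \<noteq> 0" using bd by (simp_all add: A_def B_def of_nat_eq_0)
  have "of_nat p = (0::'a)" by (simp only: of_nat_eq_0 dvd_refl)
  then have sum0: "A ^ 2 + B ^ 2 = 0" unfolding p(1) by (simp add: A_def B_def)
  define i where "i = A / B"
  have "i ^ 2 = A ^ 2 / B ^ 2" by (simp add: i_def power_divide)
  also have "A ^ 2 = - (B ^ 2)" using sum0 by (simp add: add_eq_0_iff2)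
  finally have i: "i ^ 2 = -1" using AB by simp
  have id: "2 * (2 + s) * (2 + i) = (2 + s + i) ^ 2"
  proof -
    have "(2 + s + i) ^ 2 = 2 * (2 + s) * (2 + i) + (s ^ 2 + i ^ 2 - 4)"
      by (simp add: algebra_simps power2_eq_square)
    then show ?thesis using s i by simp
  qed
  have "(2 + s) ^ 2 - 4 * (2 + s) - 1 = s ^ 2 - 5"
    by (simp add: algebra_simps power2_eq_square)
  then have chi_s: "qchi (2 + s) = \<sigma>" using s by (intro qchi_theta) simp
  then have "2 + s \<noteq> 0" using sigma_cases by auto
  have "2 + i \<noteq> 0"
  proof
    assume "2 + i = 0"
    moreover have "(2 + i) * (2 - i) = 4 - i ^ 2" by (simp add: algebra_simps power2_eq_square)
    ultimately show False using i five_ne_0 by simp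
  qed
  have "2 + s + i \<noteq> 0"
  proof
    assume "2 + s + i = 0"
    then have "2 * (2 + s) * (2 + i) = 0" unfolding id by simp
    then show False using \<open>2 + s \<noteq> 0\<close> \<open>2 + i \<noteq> 0\<close> two_ne_0
      by (simp only: mult_eq_0_iff) simp
  qed
  from qchi_sq[OF this] have 1: "qchi (2::'a) * \<sigma> * qchi (2 + i) = 1"
    unfolding id[symmetric] qchi_mult chi_s .
  have "(2 + i) * B = of_nat (a + 2 * b)" using AB by (simp add: i_def A_def B_def algebra_simps)
  from arg_cong[OF this, of qchi] have 2: "qchi (2 + i) * \<psi> b = \<psi> (a + 2 * b)"
    by (simp only: qchi_mult \<psi>_def B_def)
  have "\<psi> a = 1" using psi_odd_dvd_y[OF p' _ _ p(2)] by simp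
  \<comment> \<open>As \<open>A ^ 2 + B ^ 2 = 0\<close>, the product \<open>2 * A * B\<close> is a
    square; with \<open>\<psi> a = 1\<close> the character of \<open>b\<close> is that of 2.\<close>
  have sq: "(A + B) ^ 2 = 2 * A * B" using sum0 by (simp add: power2_eq_square algebra_simps add_eq_0_iff2)
  then have "A + B \<noteq> 0" using AB two_ne_0 by auto
  from qchi_sq[OF this] have "qchi (2::'a) * qchi A * qchi B = 1" unfolding sq qchi_mult .
  then have 3: "qchi (2::'a) * \<psi> b = 1" using \<open>\<psi> a = 1\<close> by (simp add: \<psi>_def A_def B_def)
  have "\<psi> b = 1 \<or> \<psi> b = -1" using AB unfolding \<psi>_def B_def by (intro qchi_cases)
  then have "\<sigma> = \<psi> (a + 2 * b)"
    using 1 2 3 qchi_2_cases sigma_cases by (elim disjE) simp_all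
  also have "\<dots> = chi5 (a + 2 * b)" by (rule psi_a_2b[OF p])
  also have "\<dots> = (if 5 dvd b then 1 else -1)"
    using p_mod(3) unfolding p(1) by (rule chi5_2a_b)
  finally show ?thesis .
qed

text \<open>\<open>X / (Y * s)\<close> is a square root of -1, so its character is that of 2 and
  \<open>\<sigma> = \<psi> 2 * \<psi> x * \<psi> y\<close>. The odd parts of \<open>x\<close> and
  \<open>y\<close> are evaluated by reciprocity, the powers of 2 through \<open>p\<close> modulo
  8.\<close>

lemma sigma_x2_5y2:
  assumes p: "p = x ^ 2 + 5 * y ^ 2"
  shows "\<sigma> = (if even y then 1 else -1)"
proof -
  note bd = quadratic_form_bounds[OF p]
  obtain s :: 'a where s: "s ^ 2 = 5" "qchi s = \<sigma>" "s \<noteq> 0" by (rule sqrt_5)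
  define X Y where "X = (of_nat x :: 'a)" and "Y = (of_nat y :: 'a)"
  have XY: "X \<noteq> 0" "Y \<noteq> 0" using bd by (simp_all add: X_def Y_def of_nat_eq_0)
  have "of_nat p = (0::'a)" by (simp only: of_nat_eq_0 dvd_refl)
  then have sum0: "X ^ 2 + 5 * Y ^ 2 = 0" unfolding p by (simp add: X_def Y_def)
  have "(X / (Y * s)) ^ 2 = X ^ 2 / (Y ^ 2 * 5)" by (simp add: power_divide power_mult_distrib s)
  also have "X ^ 2 = - (Y ^ 2 * 5)" using sum0 by (simp add: add_eq_0_iff2 mult.commute)
  finally have "(X / (Y * s)) ^ 2 = -1" using XY five_ne_0 by simp
  then have "qchi (X / (Y * s)) = \<psi> 2" by (rule qchi_i)
  moreover have "X / (Y * s) * (Y * s) = X" using XY s(3) by simp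
  from arg_cong[OF this, of qchi] have "qchi (X / (Y * s)) * (\<psi> y * \<sigma>) = \<psi> x"
    by (simp only: qchi_mult s(2) \<psi>_def X_def Y_def)
  ultimately have "\<psi> x = \<psi> 2 * (\<psi> y * \<sigma>)" by simp
  moreover have c2: "\<psi> 2 = 1 \<or> \<psi> 2 = -1" using qchi_2_cases by (simp add: \<psi>_def)
  moreover have "\<psi> y = 1 \<or> \<psi> y = -1" using XY unfolding \<psi>_def Y_def by (intro qchi_cases)
  ultimately have \<sigma>: "\<sigma> = \<psi> 2 * \<psi> x * \<psi> y" by auto
  have chi5_x: "chi5 x = 1"
  proof -
    have "(x ^ 2 + 5 * y ^ 2) mod 5 = 1" using p_mod(3) unfolding p .
    then have "(x mod 5) ^ 2 mod 5 = 1" by (simp add: power_mod)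
    then show ?thesis using mod_5_cases[of x] by (elim disjE) (simp_all add: chi5_def)
  qed
  have mod_8: "8 dvd N \<longleftrightarrow> (x ^ 2 mod 8 + 5 * (y ^ 2 mod 8)) mod 8 = 1"
  proof -
    have "(x ^ 2 mod 8 + 5 * (y ^ 2 mod 8)) mod 8 = p mod 8"
      unfolding p by (subst mod_add_right_eq[of "x ^ 2 mod 8" "5 * (y ^ 2 mod 8)", symmetric])
        (simp only: mod_mult_right_eq mod_add_eq)
    moreover have "8 dvd N \<longleftrightarrow> p mod 8 = 1" by presburger
    ultimately show ?thesis by (simp only:)
  qed
  show ?thesis
  proof (cases "even y")
    case True
    then have "odd x" using p_mod(6) unfolding p by simp
    then have "\<psi> x = 1" using psi_odd_dvd_x[OF p, of x] chi5_x by simp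
    obtain t m where m: "y = 2 ^ t * m" "odd m" using odd_part bd(2) by auto
    have "\<psi> m = 1" using psi_odd_dvd_y[OF p _ _ m(2)] m(1) by simp
    then have "\<psi> y = \<psi> 2 ^ t" by (simp add: m psi_mult psi_power)
    \<comment> \<open>For \<open>t = 1\<close> the factor \<open>\<psi> y = \<psi> 2\<close> cancels
      the other \<open>\<psi> 2\<close>; for \<open>t \<ge> 2\<close>,
      \<open>p \<equiv> x ^ 2 \<equiv> 1\<close> modulo 8.\<close>
    moreover have "\<psi> 2 = 1" if "t \<noteq> 1"
    proof -
      have "t \<ge> 2" using that True m by (cases t) auto
      then have "4 dvd y" unfolding m(1) using le_imp_power_dvd[of 2 t "2::nat"] by simp
      then obtain k where "y = 4 * k" by (elim dvdE)
      then have "y ^ 2 = 8 * (2 * k ^ 2)" by (simp add: power_mult_distrib)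
      then have "8 dvd N" using mod_8 odd_square_mod_8[OF \<open>odd x\<close>] by simp
      then show ?thesis by (simp add: psi_2)
    qed
    ultimately have "\<sigma> = 1" using \<sigma> c2 \<open>\<psi> x = 1\<close> by (cases "t = 1") auto
    then show ?thesis using True by simp
  next
    case False
    then have "even x" using p_mod(6) unfolding p by simp
    have "\<psi> y = 1" using psi_odd_dvd_y[OF p _ _ False] by simp
    obtain r m where m: "x = 2 ^ r * m" "odd m" using odd_part bd(1) by auto
    \<comment> \<open>2 is a nonresidue modulo 5, so \<open>chi5 x = 1\<close> gives the odd part of
      \<open>x\<close> the symbol \<open>(-1) ^ r\<close>.\<close>
    have "chi5 (2 ^ r) = (-1) ^ r" by (induction r) (simp_all add: chi5_mult, simp_all add: chi5_def)
    then have "(-1) ^ r * chi5 m = 1" using chi5_x unfolding m(1) by (simp add: chi5_mult)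
    then have "chi5 m = (-1) ^ r" by (cases "even r") auto
    moreover have "\<psi> m = chi5 m" using psi_odd_dvd_x[OF p m(2)] m(1) by simp
    ultimately have "\<psi> x = \<psi> 2 ^ r * (-1) ^ r" by (simp add: m(1) psi_mult psi_power)
    \<comment> \<open>Modulo 8, \<open>p \<equiv> x ^ 2 + 5\<close>, which is 1 for
      \<open>r = 1\<close> and 5 for larger \<open>r\<close>.\<close>
    moreover have "\<psi> 2 = (if r = 1 then 1 else -1)"
    proof (cases "r = 1")
      case True
      then have "x ^ 2 = 4 * m ^ 2" using m by (simp add: power_mult_distrib)
      moreover have "4 * m ^ 2 mod 8 = 4 * (m ^ 2 mod 8) mod 8" by (simp add: mod_mult_right_eq)
      ultimately have "x ^ 2 mod 8 = 4" using odd_square_mod_8[OF m(2)] by simp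
      then have "8 dvd N" using mod_8 odd_square_mod_8[OF False] by simp
      then show ?thesis using True by (simp add: psi_2)
    next
      case r: False
      have "r \<ge> 2" using r \<open>even x\<close> m by (cases r) auto
      then have "4 dvd x" unfolding m(1) using le_imp_power_dvd[of 2 r "2::nat"] by simp
      then obtain k where "x = 4 * k" by (elim dvdE)
      then have "x ^ 2 = 8 * (2 * k ^ 2)" by (simp add: power_mult_distrib)
      then have "\<not> 8 dvd N" using mod_8 odd_square_mod_8[OF False] by simp
      then show ?thesis using r by (simp add: psi_2)
    qed
    ultimately have "\<sigma> = -1" using \<sigma> \<open>\<psi> y = 1\<close>
      by (cases "r = 1") (simp_all flip: power_mult_distrib)
    then show ?thesis using False by simp
  qed
qed

section \<open>The representations in conditions (vi) and (vii)\<close>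

lemma ex_x2_20y2_iff: "(\<exists>x y :: int. int p = x ^ 2 + 20 * y ^ 2) \<longleftrightarrow> \<sigma> \<noteq> -1"
proof
  assume "\<exists>x y :: int. int p = x ^ 2 + 20 * y ^ 2"
  then obtain x y :: int where xy: "int p = x ^ 2 + 20 * y ^ 2" by blast
  have "int p = int (nat \<bar>x\<bar> ^ 2 + 5 * (2 * nat \<bar>y\<bar>) ^ 2)"
    using xy by (simp add: power_mult_distrib)
  then have "p = nat \<bar>x\<bar> ^ 2 + 5 * (2 * nat \<bar>y\<bar>) ^ 2" by (simp only: of_nat_eq_iff)
  from sigma_x2_5y2[OF this] show "\<sigma> \<noteq> -1" by simp
next
  assume \<sigma>: "\<sigma> \<noteq> -1"
  obtain s :: 'a where s: "s ^ 2 = 5" by (rule sqrt_5)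
  \<comment> \<open>A square root of -1 times \<open>s\<close> is a square root of -5. It yields
    some representation by \<open>x ^ 2 + 5 * y ^ 2\<close>, in which \<open>\<sigma>\<close> then
    decides the parity of \<open>y\<close>.\<close>
  obtain r :: int where r: "of_int r = \<alpha> ^ (N div 4) * s" using ex_of_int by metis
  have "of_int (r ^ 2 + 5) = (0::'a)"
  proof -
    have "(\<alpha> ^ (N div 4)) ^ 2 = \<zeta> ^ 5"
      using twenty by (auto simp: \<zeta>_def simp flip: power_mult elim!: dvdE)
    then show ?thesis by (simp add: r power_mult_distrib s zeta_5)
  qed
  then have "int p dvd r ^ 2 + 5" by (simp only: of_int_eq_0)
  then obtain x y where xy: "p = x ^ 2 + 5 * y ^ 2"
    using prime_eq_x2_5y2[OF prime_p p_mod(1)] by blast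
  then have "even y" using sigma_x2_5y2[OF xy] \<sigma> by (auto split: if_splits)
  then obtain z where "y = 2 * z" by (elim evenE)
  then have "int p = int x ^ 2 + 20 * int z ^ 2" unfolding xy by (simp add: power_mult_distrib)
  then show "\<exists>x y :: int. int p = x ^ 2 + 20 * y ^ 2" by blast
qed

lemma ex_x2_100y2_iff: "(\<exists>x y :: int. int p = x ^ 2 + 100 * y ^ 2) \<longleftrightarrow> \<sigma> \<noteq> -1"
proof
  assume "\<exists>x y :: int. int p = x ^ 2 + 100 * y ^ 2"
  then obtain x y :: int where xy: "int p = x ^ 2 + 100 * y ^ 2" by blast
  have "int p = int (nat \<bar>x\<bar> ^ 2 + (10 * nat \<bar>y\<bar>) ^ 2)"
    using xy by (simp add: power_mult_distrib)
  then have *: "p = nat \<bar>x\<bar> ^ 2 + (10 * nat \<bar>y\<bar>) ^ 2" by (simp only: of_nat_eq_iff)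
  have "odd (nat \<bar>x\<bar>)" using p_mod(6) unfolding * by simp
  moreover have "5 dvd 10 * nat \<bar>y\<bar>" by simp
  ultimately show "\<sigma> \<noteq> -1" using sigma_two_squares[OF *] by simp
next
  assume \<sigma>: "\<sigma> \<noteq> -1"
  obtain r :: int where r: "of_int r = \<alpha> ^ (N div 4)" using ex_of_int by metis
  have "of_int (r ^ 2 + 1) = (0::'a)"
  proof -
    have "(\<alpha> ^ (N div 4)) ^ 2 = \<zeta> ^ 5"
      using twenty by (auto simp: \<zeta>_def simp flip: power_mult elim!: dvdE)
    then show ?thesis by (simp add: r zeta_5)
  qed
  then have "int p dvd r ^ 2 + 1" by (simp only: of_int_eq_0)
  then obtain x y where xy: "p = x ^ 2 + y ^ 2"
    using sum_of_two_squares[OF prime_p] by blast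
  \<comment> \<open>Exactly one of the two squares is odd. With the odd one first,
    \<open>\<sigma>\<close> decides whether 5 divides the even \<open>b\<close>, and then 100
    divides \<open>b ^ 2\<close>.\<close>
  have "\<exists>a b. p = a ^ 2 + b ^ 2 \<and> odd a \<and> even b"
  proof (cases "even x")
    case True
    then have "odd y" using p_mod(6) unfolding xy by simp
    then show ?thesis using True xy by (metis add.commute)
  next
    case False
    then have "even y" using p_mod(6) unfolding xy by simp
    then show ?thesis using False xy by blast
  qed
  then obtain a b where ab: "p = a ^ 2 + b ^ 2" "odd a" "even b" by blast
  then have "5 dvd b" using sigma_two_squares[OF ab(1,2)] \<sigma> by (auto split: if_splits)
  then have "10 dvd b" using ab(3) by presburger
  then obtain z where "b = 10 * z" by (elim dvdE)
  then have "int p = int a ^ 2 + 100 * int z ^ 2" unfolding ab(1) by (simp add: power_mult_distrib)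
  then show "\<exists>x y :: int. int p = x ^ 2 + 100 * y ^ 2" by blast
qed

end

section \<open>Reduction of every condition to \<open>\<sigma> = -1\<close>\<close>

theorem theorem4p1:
  fixes \<alpha> :: "'a::{field,finite}"
  assumes q20: "CARD('a) mod 20 = 1"
    and prim: "primitive_root \<alpha>"
  shows
    "(gives_3design TYPE('a) 5 \<longleftrightarrow> gives_3design TYPE('a) 10)
   \<and> (gives_3design TYPE('a) 5 \<longleftrightarrow> qchi (1 + \<alpha> ^ ((CARD('a) - 1) div 5)) = -1)
   \<and> (gives_3design TYPE('a) 5 \<longleftrightarrow>
        (\<exists>\<theta>::'a. \<theta> \<noteq> 0 \<and> qchi \<theta> = -1 \<and> \<theta> ^ 2 - 4 * \<theta> - 1 = 0))
   \<and> (gives_3design TYPE('a) 5 \<longleftrightarrow> \<not> (\<exists>n::nat. (of_nat 5 :: 'a) = (\<alpha> ^ 4) ^ n))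
   \<and> (prime (CARD('a)) \<longrightarrow>
        (gives_3design TYPE('a) 5 \<longleftrightarrow>
           \<not> (\<exists>x y :: int. int (CARD('a)) = x ^ 2 + 20 * y ^ 2))
      \<and> (gives_3design TYPE('a) 5 \<longleftrightarrow>
           \<not> (\<exists>x y :: int. int (CARD('a)) = x ^ 2 + 100 * y ^ 2)))"
proof -
  define N where "N = CARD('a) - 1"
  have card: "CARD('a) = Suc N" using q20 unfolding N_def by presburger
  have twenty: "20 dvd N" using q20 unfolding card by presburger
  then have "even N" by presburger
  then interpret twenty_dvd \<alpha> N
    using prim card twenty by unfold_locales
  have N: "CARD('a) - 1 = N" by (simp add: N_def)
  \<comment> \<open>The locale of prime fields is entered under the assumption of primality; its
    results leave it as statements about \<open>\<sigma>\<close>.\<close>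
  have primes: "(\<exists>x y :: int. int (CARD('a)) = x ^ 2 + 20 * y ^ 2) \<longleftrightarrow> \<sigma> \<noteq> -1"
    "(\<exists>x y :: int. int (CARD('a)) = x ^ 2 + 100 * y ^ 2) \<longleftrightarrow> \<sigma> \<noteq> -1" if "prime (CARD('a))"
  proof -
    interpret prime_twenty_dvd \<alpha> N
      using that card by unfold_locales simp
    show "(\<exists>x y :: int. int (CARD('a)) = x ^ 2 + 20 * y ^ 2) \<longleftrightarrow> \<sigma> \<noteq> -1"
      "(\<exists>x y :: int. int (CARD('a)) = x ^ 2 + 100 * y ^ 2) \<longleftrightarrow> \<sigma> \<noteq> -1"
      using ex_x2_20y2_iff ex_x2_100y2_iff by (simp_all only: card)
  qed
  have "qchi (1 + \<alpha> ^ ((CARD('a) - 1) div 5)) = \<sigma>"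
    by (simp only: \<sigma>_def zeta_2 N)
  then show ?thesis
    using primes by (simp only: gives_3design_5 gives_3design_10 ex_theta_iff five_fourth_power_iff) blast
qed

end
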